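(* Let $0<\xi_1<\xi_2<\cdots$ with $\xi_n\nearrow1$, such that $W_\xi:=\mathrm{shift}(\xi_1,\xi_2,\ldots)$ is subnormal with Berger measure $\nu$ and $\frac1{s^2}\in L^1(\nu)$. Put $\xi_e:=\left(\int\frac1s\,d\nu(s)\right)^{-1/2}$. Let $a>0$ be such that $$\sqrt{\frac{\xi_e^2}{2}}<a\le\sqrt{\frac{\xi_e^2+\xi_e^4}{2}}\qquad\text{and}\qquad a\le\frac1{\xi_e}\left(\int\frac1{s^2}\,d\nu(s)\right)^{-1/2},$$ and define $b:=\sqrt{2a^2-\xi_e^2}$. Let $\mathbf{T}\equiv(T_1,T_2)$ be the $2$-variable weighted shift on $\ell^2(\mathbb{Z}_+^2)$ with weights $$\alpha_{(0,0)}=a,\quad\alpha_{(1,0)}=\xi_e,\quad\alpha_{(k_1,0)}=\xi_{k_1-1}\ (k_1\ge2),$$ $$\alpha_{(0,1)}=b,\quad\alpha_{(0,k_2)}=\frac{\xi_{k_2-1}b}{\xi_e}\ (k_2\ge2),\quad\alpha_{(k_1,k_2)}=\xi_{k_1}\ (k_1,k_2\ge1),$$ and $\beta_{(k_1,k_2)}=\alpha_{(k_2,k_1)}$ for all $(k_1,k_2)\in\mathbb{Z}_+^2$. Then $\mathbf{T}$ satisfies all of the following conditions: (i) $0<\xi_1<\xi_2<\cdots<\xi_n\nearrow1$; (ii) $W_\xi$ is subnormal with Berger measure $\nu$; (iii) $\frac1{s^2}\in L^1(\nu)$; (iv) $\xi_e=\left(\int\frac1s\,d\nu(s)\right)^{-1/2}$;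 (v) $a\le\frac1{\xi_e}\left(\int\frac1{s^2}\,d\nu(s)\right)^{-1/2}$; (vi) $b\le\xi_e^2$; (vii) $a^2\le\frac{b^2+\xi_e^2}{2}$; moreover, $\mathbf{T}$ is hyponormal and is not subnormal.
   Context: A pair $\mathbf{T}=(T_1,T_2)$ of bounded operators on a Hilbert space $\mathcal H$ is (jointly) hyponormal if the operator matrix $\begin{pmatrix}[T_1^*,T_1]&[T_2^*,T_1]\\ [T_1^*,T_2]&[T_2^*,T_2]\end{pmatrix}$ is positive on $\mathcal H\oplus\mathcal H$, where $[S,T]=ST-TS$. It is normal if $T_1,T_2$ commute and each is normal, and subnormal if it is the restriction of a normal pair to a common invariant subspace. $\mathrm{shift}(\xi_1,\xi_2,\ldots)$ is the unilateral weighted shift on $\ell^2(\mathbb{Z}_+)$ with weight sequence $\xi_1,\xi_2,\ldots$ (that is, $e_n\mapsto\xi_{n+1}e_{n+1}$, $n\ge0$). It is subnormal iff there is a probability measure $\nu$ on $[0,\|W_\xi\|^2]$ (its Berger measure) with $\xi_1^2\cdots\xi_k^2=\int s^k\,d\nu(s)$ for all $k\ge1$. The $2$-variable weighted shift with bounded positive weights $\alpha_{\mathbf k},\beta_{\mathbf k}$ ($\mathbf k\in\mathbb{Z}_+^2$) is the pair on $\ell^2(\mathbb{Z}_+^2)$ given by $T_1e_{\mathbf k}=\alpha_{\mathbf k}e_{\mathbf k+(1,0)}$, $T_2e_{\mathbf k}=\beta_{\mathbf k}e_{\mathbf k+(0,1)}$. *)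

theory Defs
  imports "HOL-Probability.Probability"
begin

section \<open>Complex Hilbert spaces\<close>

text \<open>
  The real inner product, and hence norm, metric and topology, of the underlying \<^class>\<open>real_inner\<close>
  is the real part of the complex one; \<open>cinner\<close> is linear in its first argument.
\<close>

class complex_inner = real_inner +
  fixes scaleC :: "complex \<Rightarrow> 'a \<Rightarrow> 'a"  (infixr \<open>*\<^sub>C\<close> 75)
    and cinner :: "'a \<Rightarrow> 'a \<Rightarrow> complex"
  assumes scaleC_add_right: "c *\<^sub>C (x + y) = c *\<^sub>C x + c *\<^sub>C y"
    and scaleC_add_left: "(c + d) *\<^sub>C x = c *\<^sub>C x + d *\<^sub>C x"
    and scaleC_scaleC: "c *\<^sub>C (d *\<^sub>C x) = (c * d) *\<^sub>C x"
    and scaleC_of_real: "complex_of_real r *\<^sub>C x = r *\<^sub>R x"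
    and cinner_commute: "cinner x y = cnj (cinner y x)"
    and cinner_add_left: "cinner (x + y) z = cinner x z + cinner y z"
    and cinner_scaleC_left: "cinner (c *\<^sub>C x) y = c * cinner x y"
    and Re_cinner: "Re (cinner x y) = inner x y"

class chilbert_space = complex_inner + complete_space

instantiation prod :: (complex_inner, complex_inner) complex_inner
begin

definition scaleC_prod :: "complex \<Rightarrow> 'a \<times> 'b \<Rightarrow> 'a \<times> 'b" where
  "scaleC_prod c x = (c *\<^sub>C fst x, c *\<^sub>C snd x)"

definition cinner_prod :: "'a \<times> 'b \<Rightarrow> 'a \<times> 'b \<Rightarrow> complex" where
  "cinner_prod x y = cinner (fst x) (fst y) + cinner (snd x) (snd y)"

instance
proof
  fix x y z :: "'a \<times> 'b" and c d :: complex and r :: real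
  show "c *\<^sub>C (x + y) = c *\<^sub>C x + c *\<^sub>C y"
    by (simp add: scaleC_prod_def scaleC_add_right)
  show "(c + d) *\<^sub>C x = c *\<^sub>C x + d *\<^sub>C x"
    by (simp add: scaleC_prod_def scaleC_add_left)
  show "c *\<^sub>C (d *\<^sub>C x) = (c * d) *\<^sub>C x"
    by (simp add: scaleC_prod_def scaleC_scaleC)
  show "complex_of_real r *\<^sub>C x = r *\<^sub>R x"
    by (simp add: scaleC_prod_def scaleC_of_real scaleR_prod_def)
  show "cinner x y = cnj (cinner y x)"
    using cinner_commute[of "fst x" "fst y"] cinner_commute[of "snd x" "snd y"]
    by (simp add: cinner_prod_def)
  show "cinner (x + y) z = cinner x z + cinner y z"
    by (simp add: cinner_prod_def cinner_add_left)
  show "cinner (c *\<^sub>C x) y = c * cinner x y"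
    by (simp add: cinner_prod_def scaleC_prod_def cinner_scaleC_left algebra_simps)
  show "Re (cinner x y) = inner x y"
    by (simp add: cinner_prod_def Re_cinner inner_prod_def)
qed

end

instance prod :: (chilbert_space, chilbert_space) chilbert_space ..


section \<open>Operators\<close>

definition bounded_clinear :: "('a::complex_inner \<Rightarrow> 'b::complex_inner) \<Rightarrow> bool" where
  "bounded_clinear T \<longleftrightarrow> bounded_linear T \<and> (\<forall>c x. T (c *\<^sub>C x) = c *\<^sub>C T x)"

text \<open>Well defined for bounded operators on a Hilbert space, by the Riesz representation theorem.\<close>

definition cadjoint :: "('a::chilbert_space \<Rightarrow> 'b::chilbert_space) \<Rightarrow> 'b \<Rightarrow> 'a" where
  "cadjoint T = (THE S. \<forall>x y. cinner (T x) y = cinner x (S y))"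

definition commutator :: "('a::ab_group_add \<Rightarrow> 'a) \<Rightarrow> ('a \<Rightarrow> 'a) \<Rightarrow> 'a \<Rightarrow> 'a" where
  "commutator S T = (\<lambda>x. S (T x) - T (S x))"

definition positive_op :: "('a::complex_inner \<Rightarrow> 'a) \<Rightarrow> bool" where
  "positive_op A \<longleftrightarrow> bounded_clinear A \<and> (\<forall>x. cinner (A x) x \<in> \<real>\<^sub>\<ge>\<^sub>0)"

definition op_matrix ::
  "('a::ab_group_add \<Rightarrow> 'a) \<Rightarrow> ('a \<Rightarrow> 'a) \<Rightarrow> ('a \<Rightarrow> 'a) \<Rightarrow> ('a \<Rightarrow> 'a) \<Rightarrow> 'a \<times> 'a \<Rightarrow> 'a \<times> 'a" where
  "op_matrix A B C D = (\<lambda>(x, y). (A x + B y, C x + D y))"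

definition hyponormal_pair ::
  "('a::chilbert_space \<Rightarrow> 'a) \<Rightarrow> ('a \<Rightarrow> 'a) \<Rightarrow> bool" where
  "hyponormal_pair T1 T2 \<longleftrightarrow>
     bounded_clinear T1 \<and> bounded_clinear T2 \<and>
     positive_op (op_matrix
       (commutator (cadjoint T1) T1) (commutator (cadjoint T2) T1)
       (commutator (cadjoint T1) T2) (commutator (cadjoint T2) T2))"

definition normal_op :: "('a::chilbert_space \<Rightarrow> 'a) \<Rightarrow> bool" where
  "normal_op N \<longleftrightarrow> bounded_clinear N \<and> cadjoint N \<circ> N = N \<circ> cadjoint N"

definition normal_pair :: "('a::chilbert_space \<Rightarrow> 'a) \<Rightarrow> ('a \<Rightarrow> 'a) \<Rightarrow> bool" where
  "normal_pair N1 N2 \<longleftrightarrow> N1 \<circ> N2 = N2 \<circ> N1 \<and> normal_op N1 \<and> normal_op N2"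

definition isometric_embedding :: "('a::complex_inner \<Rightarrow> 'b::complex_inner) \<Rightarrow> bool" where
  "isometric_embedding V \<longleftrightarrow> bounded_clinear V \<and> (\<forall>x. norm (V x) = norm x)"

text \<open>
  The larger Hilbert space containing the domain \<open>'a\<close> of the operators is a type \<open>'k\<close>, into which
  \<open>'a\<close> is embedded isometrically; the intertwining relations say that the image of the embedding is
  invariant and that the operators are the restrictions to it.  HOL has no quantification over types
  inside a formula, so \<open>'k\<close> is a parameter of these predicates, and the quantifier over Hilbert
  spaces is the implicit universal quantifier over the type variable of a theorem.  Thus
  \<open>\<not> subnormal_pair TYPE('k) T1 T2\<close> with a free \<open>'k\<close> states that \<open>(T1, T2)\<close> has no normal extension
  to any Hilbert space, and a premise \<open>subnormal TYPE('k) T\<close>, with a \<open>'k\<close> that is otherwise free,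
  states that \<open>T\<close> has one to some Hilbert space.
\<close>

definition subnormal :: "'k::chilbert_space itself \<Rightarrow> ('a::chilbert_space \<Rightarrow> 'a) \<Rightarrow> bool" where
  "subnormal _ T \<longleftrightarrow>
     (\<exists>(N :: 'k \<Rightarrow> 'k) (V :: 'a \<Rightarrow> 'k).
        normal_op N \<and> isometric_embedding V \<and> (\<forall>x. N (V x) = V (T x)))"

definition subnormal_pair ::
  "'k::chilbert_space itself \<Rightarrow> ('a::chilbert_space \<Rightarrow> 'a) \<Rightarrow> ('a \<Rightarrow> 'a) \<Rightarrow> bool" where
  "subnormal_pair _ T1 T2 \<longleftrightarrow>
     (\<exists>(N1 :: 'k \<Rightarrow> 'k) (N2 :: 'k \<Rightarrow> 'k) (V :: 'a \<Rightarrow> 'k).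
        normal_pair N1 N2 \<and> isometric_embedding V \<and>
        (\<forall>x. N1 (V x) = V (T1 x)) \<and> (\<forall>x. N2 (V x) = V (T2 x)))"


section \<open>The spaces of square-summable families\<close>

typedef 'i ell2 = "{x :: 'i \<Rightarrow> complex. (\<lambda>i. (cmod (x i))\<^sup>2) summable_on UNIV}"
  by (rule exI[of _ "\<lambda>_. 0"]) simp

setup_lifting type_definition_ell2

lemma Rep_ell2_summable: "(\<lambda>i. (cmod (Rep_ell2 x i))\<^sup>2) summable_on UNIV"
  using Rep_ell2[of x] by simp

lemma ell2_prod_summable:
  fixes x y :: "'i \<Rightarrow> complex"
  assumes "(\<lambda>i. (cmod (x i))\<^sup>2) summable_on UNIV" and "(\<lambda>i. (cmod (y i))\<^sup>2) summable_on UNIV"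
  shows "(\<lambda>i. x i * cnj (y i)) summable_on UNIV"
proof -
  have "(\<lambda>i. cmod (x i * cnj (y i))) summable_on UNIV"
  proof (rule summable_on_comparison_test)
    show "(\<lambda>i. (cmod (x i))\<^sup>2 + (cmod (y i))\<^sup>2) summable_on UNIV"
      using assms by (rule summable_on_add)
    fix i
    have "0 \<le> (cmod (x i))\<^sup>2 + (cmod (y i))\<^sup>2 - 2 * (cmod (x i) * cmod (y i))"
      using zero_le_power2[of "cmod (x i) - cmod (y i)"] by (simp add: power2_diff)
    moreover have "0 \<le> cmod (x i) * cmod (y i)"
      by simp
    ultimately have "cmod (x i) * cmod (y i) \<le> (cmod (x i))\<^sup>2 + (cmod (y i))\<^sup>2"
      by linarith
    then show "cmod (x i * cnj (y i)) \<le> (cmod (x i))\<^sup>2 + (cmod (y i))\<^sup>2"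
      by (simp add: norm_mult)
  qed simp
  then show ?thesis
    by (rule abs_summable_summable)
qed

lemma ell2_add_summable:
  fixes x y :: "'i \<Rightarrow> complex"
  assumes "(\<lambda>i. (cmod (x i))\<^sup>2) summable_on UNIV" and "(\<lambda>i. (cmod (y i))\<^sup>2) summable_on UNIV"
  shows "(\<lambda>i. (cmod (x i + y i))\<^sup>2) summable_on UNIV"
proof (rule summable_on_comparison_test)
  show "(\<lambda>i. 2 * (cmod (x i))\<^sup>2 + 2 * (cmod (y i))\<^sup>2) summable_on UNIV"
    using assms by (intro summable_on_add summable_on_cmult_right)
  fix i
  have "(cmod (x i + y i))\<^sup>2 \<le> (cmod (x i) + cmod (y i))\<^sup>2"
    by (intro power_mono norm_triangle_ineq) simp
  also have "\<dots> \<le> 2 * (cmod (x i))\<^sup>2 + 2 * (cmod (y i))\<^sup>2"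
    using zero_le_power2[of "cmod (x i) - cmod (y i)"] by (simp add: power2_diff power2_sum)
  finally show "(cmod (x i + y i))\<^sup>2 \<le> 2 * (cmod (x i))\<^sup>2 + 2 * (cmod (y i))\<^sup>2" .
qed simp

lemma ell2_scale_summable:
  fixes x :: "'i \<Rightarrow> complex"
  assumes "(\<lambda>i. (cmod (x i))\<^sup>2) summable_on UNIV"
  shows "(\<lambda>i. (cmod (c * x i))\<^sup>2) summable_on UNIV"
  using summable_on_cmult_right[OF assms, of "(cmod c)\<^sup>2"]
  by (simp add: norm_mult power_mult_distrib)

lemma infsum_mult_cnj_self:
  assumes "(\<lambda>i. (cmod (x i))\<^sup>2) summable_on UNIV"
  shows "(\<Sum>\<^sub>\<infinity>i. x i * cnj (x i)) = complex_of_real (\<Sum>\<^sub>\<infinity>i. (cmod (x i))\<^sup>2)"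
proof -
  have "(\<Sum>\<^sub>\<infinity>i. x i * cnj (x i)) = (\<Sum>\<^sub>\<infinity>i. complex_of_real ((cmod (x i))\<^sup>2))"
    by (simp only: complex_norm_square)
  also have "\<dots> = complex_of_real (\<Sum>\<^sub>\<infinity>i. (cmod (x i))\<^sup>2)"
    using has_sum_of_real[OF has_sum_infsum[OF assms]] by (rule infsumI)
  finally show ?thesis .
qed

instantiation ell2 :: (type) complex_inner
begin

lift_definition zero_ell2 :: "'a ell2" is "\<lambda>_. 0"
  by simp

lift_definition plus_ell2 :: "'a ell2 \<Rightarrow> 'a ell2 \<Rightarrow> 'a ell2" is "\<lambda>x y i. x i + y i"
  by (rule ell2_add_summable)

lift_definition uminus_ell2 :: "'a ell2 \<Rightarrow> 'a ell2" is "\<lambda>x i. - x i"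
  by simp

definition minus_ell2 :: "'a ell2 \<Rightarrow> 'a ell2 \<Rightarrow> 'a ell2" where
  "minus_ell2 x y = x + (- y)"

lift_definition scaleC_ell2 :: "complex \<Rightarrow> 'a ell2 \<Rightarrow> 'a ell2" is "\<lambda>c x i. c * x i"
  by (rule ell2_scale_summable)

definition scaleR_ell2 :: "real \<Rightarrow> 'a ell2 \<Rightarrow> 'a ell2" where
  "scaleR_ell2 r x = complex_of_real r *\<^sub>C x"

definition cinner_ell2 :: "'a ell2 \<Rightarrow> 'a ell2 \<Rightarrow> complex" where
  "cinner_ell2 x y = (\<Sum>\<^sub>\<infinity>i. Rep_ell2 x i * cnj (Rep_ell2 y i))"

definition inner_ell2 :: "'a ell2 \<Rightarrow> 'a ell2 \<Rightarrow> real" where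
  "inner_ell2 x y = Re (cinner x y)"

definition norm_ell2 :: "'a ell2 \<Rightarrow> real" where
  "norm_ell2 x = sqrt (\<Sum>\<^sub>\<infinity>i. (cmod (Rep_ell2 x i))\<^sup>2)"

definition sgn_ell2 :: "'a ell2 \<Rightarrow> 'a ell2" where
  "sgn_ell2 x = inverse (norm x) *\<^sub>R x"

definition dist_ell2 :: "'a ell2 \<Rightarrow> 'a ell2 \<Rightarrow> real" where
  "dist_ell2 x y = norm (x - y)"

definition uniformity_ell2 :: "('a ell2 \<times> 'a ell2) filter" where
  "uniformity_ell2 = (INF e\<in>{0 <..}. principal {(x, y). dist x y < e})"

definition open_ell2 :: "'a ell2 set \<Rightarrow> bool" where
  "open_ell2 U \<longleftrightarrow> (\<forall>x\<in>U. eventually (\<lambda>(x', y). x' = x \<longrightarrow> y \<in> U) uniformity)"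

instance
proof
  fix x y z :: "'a ell2" and c d :: complex and r s :: real
  note S = ell2_prod_summable[OF Rep_ell2_summable Rep_ell2_summable]
  show "x + y + z = x + (y + z)" by transfer (simp add: add.assoc)
  show "x + y = y + x" by transfer (simp add: add.commute)
  show "0 + x = x" by transfer simp
  show "- x + x = 0" by transfer simp
  show "x - y = x + - y" by (rule minus_ell2_def)
  show addC: "c *\<^sub>C (x + y) = c *\<^sub>C x + c *\<^sub>C y" for c
    by transfer (simp add: distrib_left)
  show addC': "(c + d) *\<^sub>C x = c *\<^sub>C x + d *\<^sub>C x" for c d
    by transfer (simp add: distrib_right)
  show mulC: "c *\<^sub>C (d *\<^sub>C x) = (c * d) *\<^sub>C x" for c d
    by transfer (simp add: mult.assoc)
  show "complex_of_real r *\<^sub>C x = r *\<^sub>R x" by (simp add: scaleR_ell2_def)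
  show "r *\<^sub>R (x + y) = r *\<^sub>R x + r *\<^sub>R y" by (simp add: scaleR_ell2_def addC)
  show "(r + s) *\<^sub>R x = r *\<^sub>R x + s *\<^sub>R x" by (simp add: scaleR_ell2_def addC')
  show "r *\<^sub>R s *\<^sub>R x = (r * s) *\<^sub>R x" by (simp add: scaleR_ell2_def mulC)
  show "1 *\<^sub>R x = x" unfolding scaleR_ell2_def by transfer simp
  show "sgn x = inverse (norm x) *\<^sub>R x" by (rule sgn_ell2_def)
  show "dist x y = norm (x - y)" by (rule dist_ell2_def)
  show "uniformity = (INF e\<in>{0 <..}. principal {(x, y). dist (x::'a ell2) y < e})"
    by (rule uniformity_ell2_def)
  show "open U \<longleftrightarrow> (\<forall>x\<in>U. eventually (\<lambda>(x', y). x' = x \<longrightarrow> y \<in> U) uniformity)" for U :: "'a ell2 set"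
    by (rule open_ell2_def)
  show comm: "cinner x y = cnj (cinner y x)" for x y :: "'a ell2"
    by (simp add: cinner_ell2_def mult.commute flip: infsum_cnj)
  show add: "cinner (x + y) z = cinner x z + cinner y z"
    by (simp add: cinner_ell2_def plus_ell2.rep_eq distrib_right infsum_add S)
  show scale: "cinner (c *\<^sub>C x) y = c * cinner x y" for c
    by (simp add: cinner_ell2_def scaleC_ell2.rep_eq mult.assoc infsum_cmult_right S)
  show "Re (cinner x y) = inner x y" by (simp add: inner_ell2_def)
  show "inner x y = inner y x" using comm[of x y] by (simp add: inner_ell2_def)
  show "inner (x + y) z = inner x z + inner y z" by (simp add: inner_ell2_def add)
  show "inner (r *\<^sub>R x) y = r * inner x y" by (simp add: inner_ell2_def scaleR_ell2_def scale)
  have self: "inner x x = (\<Sum>\<^sub>\<infinity>i. (cmod (Rep_ell2 x i))\<^sup>2)"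
    by (simp add: inner_ell2_def cinner_ell2_def infsum_mult_cnj_self[OF Rep_ell2_summable])
  show "0 \<le> inner x x" by (simp add: self infsum_nonneg)
  show "norm x = sqrt (inner x x)" by (simp add: self norm_ell2_def)
  show "inner x x = 0 \<longleftrightarrow> x = 0"
  proof
    assume "inner x x = 0"
    then have "(cmod (Rep_ell2 x i))\<^sup>2 = 0" for i
      using nonneg_infsum_le_0D[of "\<lambda>i. (cmod (Rep_ell2 x i))\<^sup>2" UNIV i] Rep_ell2_summable[of x]
      by (simp add: self)
    then show "x = 0"
      by (simp add: zero_ell2.rep_eq fun_eq_iff flip: Rep_ell2_inject)
  next
    assume "x = 0"
    then show "inner x x = 0" unfolding self by (simp add: zero_ell2.rep_eq)
  qed
qed

end

lemma Rep_ell2_diff: "Rep_ell2 (x - y) i = Rep_ell2 x i - Rep_ell2 y i"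
  unfolding minus_ell2_def plus_ell2.rep_eq uminus_ell2.rep_eq by (rule add_uminus_conv_diff)

lemma norm_ell2_power2: "(norm x)\<^sup>2 = (\<Sum>\<^sub>\<infinity>i. (cmod (Rep_ell2 x i))\<^sup>2)"
  by (simp add: norm_ell2_def infsum_nonneg)

lemma norm_ell2_ge_sum:
  assumes "finite F"
  shows "(\<Sum>i\<in>F. (cmod (Rep_ell2 x i))\<^sup>2) \<le> (norm x)\<^sup>2"
  unfolding norm_ell2_power2
  by (rule finite_sum_le_infsum[OF Rep_ell2_summable assms]) auto

lemma norm_ell2_ge_coord: "cmod (Rep_ell2 x i) \<le> norm x"
  by (rule power2_le_imp_le) (use norm_ell2_ge_sum[of "{i}" x] in simp_all)

instance ell2 :: (type) chilbert_space
proof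
  fix X :: "nat \<Rightarrow> 'a ell2"
  assume "Cauchy X"
  then have cau: "\<exists>N. \<forall>m\<ge>N. \<forall>n\<ge>N. norm (X m - X n) < e" if "e > 0" for e
    using that by (simp add: Cauchy_iff)
  have "Cauchy (\<lambda>n. Rep_ell2 (X n) i)" for i
    unfolding Cauchy_iff
  proof (intro allI impI)
    fix e :: real assume "e > 0"
    from cau[OF this] show "\<exists>M. \<forall>m\<ge>M. \<forall>n\<ge>M. cmod (Rep_ell2 (X m) i - Rep_ell2 (X n) i) < e"
      by (metis Rep_ell2_diff norm_ell2_ge_coord le_less_trans)
  qed
  then have "\<exists>l. (\<lambda>n. Rep_ell2 (X n) i) \<longlonglongrightarrow> l" for i
    by (simp add: Cauchy_convergent_iff convergent_def)
  then obtain L where L: "(\<lambda>n. Rep_ell2 (X n) i) \<longlonglongrightarrow> L i" for i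
    by metis
  have fin: "\<exists>N. \<forall>n\<ge>N. \<forall>F. finite F \<longrightarrow> (\<Sum>i\<in>F. (cmod (L i - Rep_ell2 (X n) i))\<^sup>2) \<le> e\<^sup>2"
    if e: "e > 0" for e
  proof -
    obtain N where N: "norm (X m - X n) < e" if "m \<ge> N" "n \<ge> N" for m n
      using cau[OF e] by blast
    have "(\<Sum>i\<in>F. (cmod (L i - Rep_ell2 (X n) i))\<^sup>2) \<le> e\<^sup>2" if n: "n \<ge> N" and F: "finite F" for n F
    proof (rule tendsto_upperbound)
      show "(\<lambda>m. \<Sum>i\<in>F. (cmod (Rep_ell2 (X m) i - Rep_ell2 (X n) i))\<^sup>2)
              \<longlonglongrightarrow> (\<Sum>i\<in>F. (cmod (L i - Rep_ell2 (X n) i))\<^sup>2)"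
        by (intro tendsto_intros L)
      show "\<forall>\<^sub>F m in sequentially. (\<Sum>i\<in>F. (cmod (Rep_ell2 (X m) i - Rep_ell2 (X n) i))\<^sup>2) \<le> e\<^sup>2"
        using eventually_ge_at_top[of N]
      proof eventually_elim
        case (elim m)
        have "(\<Sum>i\<in>F. (cmod (Rep_ell2 (X m) i - Rep_ell2 (X n) i))\<^sup>2) \<le> (norm (X m - X n))\<^sup>2"
          using norm_ell2_ge_sum[OF F, of "X m - X n"] by (simp add: Rep_ell2_diff)
        also have "\<dots> \<le> e\<^sup>2"
          using N[OF elim n] by (intro power_mono) auto
        finally show ?case .
      qed
    qed simp
    then show ?thesis by blast
  qed
  have summ: "(\<lambda>i. (cmod (f i))\<^sup>2) summable_on UNIV"
    if "\<forall>F. finite F \<longrightarrow> (\<Sum>i\<in>F. (cmod (f i))\<^sup>2) \<le> B" for f :: "'a \<Rightarrow> complex" and B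
    using that by (intro nonneg_bdd_above_summable_on bdd_aboveI[of _ B]) auto
  obtain N1 where "\<forall>F. finite F \<longrightarrow> (\<Sum>i\<in>F. (cmod (L i - Rep_ell2 (X N1) i))\<^sup>2) \<le> 1\<^sup>2"
    using fin[of 1] by auto
  from ell2_add_summable[OF summ[OF this] Rep_ell2_summable[of "X N1"]]
  have Lsum: "(\<lambda>i. (cmod (L i))\<^sup>2) summable_on UNIV" by simp
  define l where "l = Abs_ell2 L"
  have Rl: "Rep_ell2 l = L"
    unfolding l_def using Lsum by (simp add: Abs_ell2_inverse)
  have "X \<longlonglongrightarrow> l"
    unfolding LIMSEQ_iff
  proof (intro allI impI)
    fix r :: real assume r: "r > 0"
    obtain N where N: "\<forall>n\<ge>N. \<forall>F. finite F \<longrightarrow> (\<Sum>i\<in>F. (cmod (L i - Rep_ell2 (X n) i))\<^sup>2) \<le> (r/2)\<^sup>2"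
      using fin[of "r/2"] r by auto
    have "norm (X n - l) < r" if "n \<ge> N" for n
    proof -
      have "(norm (l - X n))\<^sup>2 \<le> (r/2)\<^sup>2"
        unfolding norm_ell2_power2
        by (rule infsum_le_finite_sums[OF Rep_ell2_summable]) (use N that in \<open>simp add: Rep_ell2_diff Rl\<close>)
      then have "norm (l - X n) \<le> r/2"
        by (rule power2_le_imp_le) (use r in simp)
      then show ?thesis using r norm_minus_commute[of l "X n"] by linarith
    qed
    then show "\<exists>N. \<forall>n\<ge>N. norm (X n - l) < r" by blast
  qed
  then show "convergent X" by (auto simp: convergent_def)
qed

lift_definition ket :: "'i \<Rightarrow> 'i ell2" is "\<lambda>i j. if j = i then 1 else 0"
  by (rule finite_nonzero_values_imp_summable_on, rule finite_subset[of _ "{i}" for i]) auto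


section \<open>Weighted shifts\<close>

text \<open>
  The bounded operator with \<open>e\<^sub>i \<mapsto> w\<^sub>i e\<^bsub>\<sigma> i\<^esub>\<close>.
  It exists and is unique for injective \<open>\<sigma>\<close> and bounded \<open>w\<close>.
\<close>

definition weighted_shift :: "('i \<Rightarrow> 'i) \<Rightarrow> ('i \<Rightarrow> real) \<Rightarrow> 'i ell2 \<Rightarrow> 'i ell2" where
  "weighted_shift \<sigma> w =
     (THE T. bounded_clinear T \<and> (\<forall>i. T (ket i) = complex_of_real (w i) *\<^sub>C ket (\<sigma> i)))"

lemma bounded_clinear_eqI:
  fixes S T :: "'i ell2 \<Rightarrow> 'b::complex_inner"
  assumes S: "bounded_clinear S" and T: "bounded_clinear T" and eq: "\<And>i. S (ket i) = T (ket i)"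
  shows "S = T"
proof
  fix x :: "'i ell2"
  define D where "D y = S y - T y" for y
  have bl: "bounded_linear D"
    unfolding D_def using S T by (simp add: bounded_clinear_def bounded_linear_sub)
  have DC: "D (c *\<^sub>C y) = c *\<^sub>C D y" for c y
  proof -
    have "c *\<^sub>C (u - v) = c *\<^sub>C u - c *\<^sub>C v" for u v :: 'b
      using scaleC_add_right[of c "u - v" v] by (simp add: algebra_simps)
    then show ?thesis using S T by (simp add: D_def bounded_clinear_def)
  qed
  have sc0: "c *\<^sub>C 0 = (0::'b)" for c
    using scaleC_add_right[of c 0 "0::'b"] by simp
  define tr where "tr F = (\<Sum>i\<in>F. Rep_ell2 x i *\<^sub>C ket i)" for F
  have Rtr: "Rep_ell2 (tr F) j = (if j \<in> F then Rep_ell2 x j else 0)" if "finite F" for F j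
    unfolding tr_def using that
    by (induction F) (auto simp: zero_ell2.rep_eq plus_ell2.rep_eq scaleC_ell2.rep_eq ket.rep_eq)
  have Dtr: "D (tr F) = 0" for F
    unfolding tr_def using bl
    by (simp add: linear_sum bounded_linear.linear DC eq sc0 D_def[of "ket _"])
  have nrm: "(norm (x - tr F))\<^sup>2 = (norm x)\<^sup>2 - (\<Sum>i\<in>F. (cmod (Rep_ell2 x i))\<^sup>2)" if F: "finite F" for F
  proof -
    have "(norm (x - tr F))\<^sup>2 = (\<Sum>\<^sub>\<infinity>i\<in>UNIV - F. (cmod (Rep_ell2 x i))\<^sup>2)"
      unfolding norm_ell2_power2
      by (rule infsum_cong_neutral) (auto simp: Rep_ell2_diff Rtr[OF F])
    also have "\<dots> = (norm x)\<^sup>2 - (\<Sum>i\<in>F. (cmod (Rep_ell2 x i))\<^sup>2)"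
      unfolding norm_ell2_power2 using F Rep_ell2_summable[of x] by (subst infsum_Diff) auto
    finally show ?thesis .
  qed
  have "((\<lambda>F. \<Sum>i\<in>F. (cmod (Rep_ell2 x i))\<^sup>2) \<longlongrightarrow> (norm x)\<^sup>2) (finite_subsets_at_top UNIV)"
    using has_sum_infsum[OF Rep_ell2_summable[of x]] by (simp add: norm_ell2_power2 has_sum_def)
  then have "((\<lambda>F. sqrt ((norm x)\<^sup>2 - (\<Sum>i\<in>F. (cmod (Rep_ell2 x i))\<^sup>2))) \<longlongrightarrow> sqrt ((norm x)\<^sup>2 - (norm x)\<^sup>2))
               (finite_subsets_at_top UNIV)"
    by (intro tendsto_intros)
  then have "((\<lambda>F. sqrt ((norm x)\<^sup>2 - (\<Sum>i\<in>F. (cmod (Rep_ell2 x i))\<^sup>2))) \<longlongrightarrow> 0)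
               (finite_subsets_at_top UNIV)"
    by simp
  moreover have "\<forall>\<^sub>F F in finite_subsets_at_top UNIV.
      sqrt ((norm x)\<^sup>2 - (\<Sum>i\<in>F. (cmod (Rep_ell2 x i))\<^sup>2)) = norm (x - tr F)"
    by (rule eventually_finite_subsets_at_top_weakI) (simp flip: nrm)
  ultimately have "((\<lambda>F. norm (x - tr F)) \<longlongrightarrow> 0) (finite_subsets_at_top UNIV)"
    by (rule Lim_transform_eventually)
  then have "(tr \<longlongrightarrow> x) (finite_subsets_at_top UNIV)"
    by (subst tendsto_dist_iff) (simp add: dist_norm norm_minus_commute)
  then have "((\<lambda>F. D (tr F)) \<longlongrightarrow> D x) (finite_subsets_at_top UNIV)"
    by (rule bounded_linear.tendsto[OF bl])
  then have "D x = 0"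
    by (simp add: Dtr tendsto_const_iff)
  then show "S x = T x" by (simp add: D_def)
qed

lemma weighted_shift_exists:
  fixes \<sigma> :: "'i \<Rightarrow> 'i" and w :: "'i \<Rightarrow> real"
  assumes inj: "inj \<sigma>" and bdd: "\<And>i. \<bar>w i\<bar> \<le> B"
  shows "\<exists>T. bounded_clinear T \<and> (\<forall>i. T (ket i) = complex_of_real (w i) *\<^sub>C ket (\<sigma> i))"
proof -
  define t where "t x j = (if j \<in> range \<sigma> then w (inv \<sigma> j) * Rep_ell2 x (inv \<sigma> j) else 0)" for x j
  have tsig: "t x (\<sigma> i) = w i * Rep_ell2 x i" for x i
    using inj by (simp add: t_def)
  have hs: "((\<lambda>j. (cmod (t x j))\<^sup>2) has_sum (\<Sum>\<^sub>\<infinity>i. (cmod (w i * Rep_ell2 x i))\<^sup>2)) UNIV"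
    and le: "(\<Sum>\<^sub>\<infinity>i. (cmod (w i * Rep_ell2 x i))\<^sup>2) \<le> B\<^sup>2 * (norm x)\<^sup>2" for x
  proof -
    have B: "(cmod (w i * Rep_ell2 x i))\<^sup>2 \<le> B\<^sup>2 * (cmod (Rep_ell2 x i))\<^sup>2" for i
      using power_mono[OF bdd[of i], of 2]
      by (auto simp: norm_mult power_mult_distrib intro!: mult_right_mono)
    have s1: "(\<lambda>i. B\<^sup>2 * (cmod (Rep_ell2 x i))\<^sup>2) summable_on UNIV"
      by (intro summable_on_cmult_right Rep_ell2_summable)
    have s2: "(\<lambda>i. (cmod (w i * Rep_ell2 x i))\<^sup>2) summable_on UNIV"
      by (rule summable_on_comparison_test[OF s1 B]) auto
    show "(\<Sum>\<^sub>\<infinity>i. (cmod (w i * Rep_ell2 x i))\<^sup>2) \<le> B\<^sup>2 * (norm x)\<^sup>2"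
      unfolding norm_ell2_power2
      using infsum_mono[OF s2 s1 B] Rep_ell2_summable[of x] by (simp add: infsum_cmult_right)
    have "((\<lambda>j. (cmod (t x j))\<^sup>2) has_sum (\<Sum>\<^sub>\<infinity>i. (cmod (w i * Rep_ell2 x i))\<^sup>2)) (range \<sigma>)"
      using has_sum_infsum[OF s2] inj by (subst has_sum_reindex) (auto simp: o_def tsig)
    then show "((\<lambda>j. (cmod (t x j))\<^sup>2) has_sum (\<Sum>\<^sub>\<infinity>i. (cmod (w i * Rep_ell2 x i))\<^sup>2)) UNIV"
      by (subst has_sum_cong_neutral[where T = "range \<sigma>" and g = "\<lambda>j. (cmod (t x j))\<^sup>2"])
        (auto simp: t_def)
  qed
  define T where "T x = Abs_ell2 (t x)" for x
  have RT: "Rep_ell2 (T x) = t x" for x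
    unfolding T_def using hs[of x] by (subst Abs_ell2_inverse) (auto simp: summable_on_def)
  have add: "T (x + y) = T x + T y" for x y
    by (auto simp: Rep_ell2_inject[symmetric] fun_eq_iff RT plus_ell2.rep_eq t_def distrib_left)
  have scl: "T (c *\<^sub>C x) = c *\<^sub>C T x" for c x
    by (auto simp: Rep_ell2_inject[symmetric] fun_eq_iff RT scaleC_ell2.rep_eq t_def)
  have "(norm (T x))\<^sup>2 \<le> (\<bar>B\<bar> * norm x)\<^sup>2" for x
    using infsumI[OF hs[of x]] le[of x] unfolding norm_ell2_power2[of "T x"] RT
    by (simp add: power_mult_distrib)
  then have "norm (T x) \<le> norm x * \<bar>B\<bar>" for x
    by (metis abs_ge_zero mult.commute mult_nonneg_nonneg norm_ge_zero power2_le_imp_le)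
  then have "bounded_clinear T"
    unfolding bounded_clinear_def
    by (auto intro!: bounded_linear_intro[where K = "\<bar>B\<bar>"] simp: add scl simp flip: scaleC_of_real)
  moreover have "T (ket i) = complex_of_real (w i) *\<^sub>C ket (\<sigma> i)" for i
    using inj
    by (auto simp: Rep_ell2_inject[symmetric] fun_eq_iff RT scaleC_ell2.rep_eq t_def ket.rep_eq)
  ultimately show ?thesis by blast
qed

lemma weighted_shift:
  fixes \<sigma> :: "'i \<Rightarrow> 'i" and w :: "'i \<Rightarrow> real"
  assumes "inj \<sigma>" and "\<And>i. \<bar>w i\<bar> \<le> B"
  shows "bounded_clinear (weighted_shift \<sigma> w)"
    and "weighted_shift \<sigma> w (ket i) = complex_of_real (w i) *\<^sub>C ket (\<sigma> i)"
proof -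
  have "\<exists>!T. bounded_clinear T \<and> (\<forall>i. T (ket i) = complex_of_real (w i) *\<^sub>C ket (\<sigma> i))"
    using weighted_shift_exists[OF assms] by (auto intro: bounded_clinear_eqI)
  from theI'[OF this] show "bounded_clinear (weighted_shift \<sigma> w)"
    and "weighted_shift \<sigma> w (ket i) = complex_of_real (w i) *\<^sub>C ket (\<sigma> i)"
    by (simp_all add: weighted_shift_def)
qed

text \<open>Weight sequences are indexed from \<open>1\<close>; the value \<open>\<xi> 0\<close> is not used anywhere.\<close>

definition unilateral_shift :: "(nat \<Rightarrow> real) \<Rightarrow> nat ell2 \<Rightarrow> nat ell2" where
  "unilateral_shift \<xi> = weighted_shift Suc (\<lambda>n. \<xi> (n + 1))"

definition shift2_fst :: "(nat \<times> nat \<Rightarrow> real) \<Rightarrow> (nat \<times> nat) ell2 \<Rightarrow> (nat \<times> nat) ell2" where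
  "shift2_fst \<alpha> = weighted_shift (\<lambda>(k1, k2). (k1 + 1, k2)) \<alpha>"

definition shift2_snd :: "(nat \<times> nat \<Rightarrow> real) \<Rightarrow> (nat \<times> nat) ell2 \<Rightarrow> (nat \<times> nat) ell2" where
  "shift2_snd \<beta> = weighted_shift (\<lambda>(k1, k2). (k1, k2 + 1)) \<beta>"

definition berger_measure :: "(nat \<Rightarrow> real) \<Rightarrow> real measure \<Rightarrow> bool" where
  "berger_measure \<xi> \<nu> \<longleftrightarrow>
     sets \<nu> = sets borel \<and> prob_space \<nu> \<and> (AE s in \<nu>. s \<in> {0..(onorm (unilateral_shift \<xi>))\<^sup>2}) \<and>
     (\<forall>k\<ge>1. (\<Prod>i=1..k. (\<xi> i)\<^sup>2) = (LINT s|\<nu>. s ^ k))"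

text \<open>
  The integral is taken in \<^typ>\<open>ennreal\<close>, where \<open>1 / 0 = \<infinity>\<close>, so that the condition excludes an atom
  at \<open>0\<close>.  With real division, where \<open>1 / 0 = 0\<close>, an atom at \<open>0\<close> would go unnoticed.
\<close>

definition inverse_square_L1 :: "real measure \<Rightarrow> bool" where
  "inverse_square_L1 \<nu> \<longleftrightarrow> (\<integral>\<^sup>+ s. 1 / ennreal (s\<^sup>2) \<partial>\<nu>) < \<infinity>"

fun weight_alpha :: "(nat \<Rightarrow> real) \<Rightarrow> real \<Rightarrow> real \<Rightarrow> real \<Rightarrow> nat \<times> nat \<Rightarrow> real" where
  "weight_alpha \<xi> \<xi>e a b (k1, k2) =
     (if k2 = 0 then (if k1 = 0 then a else if k1 = 1 then \<xi>e else \<xi> (k1 - 1))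
      else if k1 = 0 then (if k2 = 1 then b else \<xi> (k2 - 1) * b / \<xi>e)
      else \<xi> k1)"

fun weight_beta :: "(nat \<Rightarrow> real) \<Rightarrow> real \<Rightarrow> real \<Rightarrow> real \<Rightarrow> nat \<times> nat \<Rightarrow> real" where
  "weight_beta \<xi> \<xi>e a b (k1, k2) = weight_alpha \<xi> \<xi>e a b (k2, k1)"

end

theory Submission
  imports Defs "HOL-Complex_Analysis.Cauchy_Integral_Formula"
begin

text \<open>
  Write \<open>x = \<xi>\<^sub>e\<close>. Integrating \<open>(1 - t s)\<^sup>2 / s \<ge> 0\<close> against \<open>\<nu>\<close> gives \<open>x \<le> \<xi> 1\<close>
  (\<open>berger_measure_inverse_moment\<close>), and the bounds on \<open>a\<close> give \<open>0 < b \<le> x\<^sup>2\<close> and \<open>2 a\<^sup>2 = b\<^sup>2 + x\<^sup>2\<close>,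
  hence \<open>a < x\<close>, as \<open>x < 1\<close>.

  Hyponormality is an inequality between norms (\<open>hyponormal_pairI\<close>) which for a shift decouples into one
  \<open>2 \<times> 2\<close> form for each lattice point (\<open>six_point_test\<close>). For the weights at hand these forms are positive, and
  the one at the origin is degenerate, with null vector \<open>(1, 1)\<close>.

  The degeneracy is what excludes subnormality. If \<open>(N\<^sub>1, N\<^sub>2)\<close> were a normal extension, put
  \<open>S = N\<^sub>1\<^sup>* N\<^sub>1 + N\<^sub>2\<^sup>* N\<^sub>2\<close>. Then \<open>\<parallel>S e - 2 a\<^sup>2 e\<parallel>\<^sup>2\<close>, for the basis vector \<open>e\<close> at the origin, can be
  computed from the weights and equals \<open>2 a\<^sup>2 (b\<^sup>2 + x\<^sup>2 - 2 a\<^sup>2) = 0\<close>. By Fuglede's theorem (\<open>fuglede\<close>), \<open>S\<close>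
  commutes with \<open>N\<^sub>1 N\<^sub>2\<close>, so that \<open>T\<^sub>1 T\<^sub>2 e\<close>, a nonzero multiple of the basis vector at \<open>(1, 1)\<close>, is also
  an eigenvector for \<open>2 a\<^sup>2\<close> (\<open>subnormal_pair_eigenvector\<close>). There \<open>\<langle>S u, u\<rangle> = 2 (\<xi> 1)\<^sup>2\<close> for unit \<open>u\<close>, so
  \<open>\<xi> 1 = a < x\<close>, a contradiction.

  Fuglede's theorem is obtained from Liouville's theorem. The exponentials are handled as vector series, and the
  adjoint comes from the Riesz representation theorem.
\<close>

section \<open>The complex inner product and the adjoint\<close>

instance chilbert_space \<subseteq> banach ..

lemma scaleC_diff_right: "c *\<^sub>C (x - y) = c *\<^sub>C x - c *\<^sub>C (y :: 'a::complex_inner)"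
  using scaleC_add_right[of c "x - y" y] by (simp add: algebra_simps)

lemma cinner_add_right: "cinner x (y + z) = cinner x y + cinner x z"
  by (metis cinner_add_left cinner_commute complex_cnj_add)

lemma cinner_scaleC_right: "cinner x (c *\<^sub>C y) = cnj c * cinner x y"
  by (metis cinner_scaleC_left cinner_commute complex_cnj_mult)

lemma cinner_scaleR_left: "cinner (r *\<^sub>R x) y = of_real r * cinner x y"
  by (simp add: cinner_scaleC_left flip: scaleC_of_real)

lemma cinner_scaleR_right: "cinner x (r *\<^sub>R y) = of_real r * cinner x y"
  by (simp add: cinner_scaleC_right flip: scaleC_of_real)

lemma cinner_minus_left: "cinner (- x) y = - cinner x y"
  using cinner_scaleR_left[of "-1" x y] by simp

lemma cinner_minus_right: "cinner x (- y) = - cinner x y"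
  using cinner_scaleR_right[of x "-1" y] by simp

lemma cinner_diff_left: "cinner (x - y) z = cinner x z - cinner y z"
  using cinner_add_left[of x "- y" z] by (simp add: cinner_minus_left)

lemma cinner_diff_right: "cinner x (y - z) = cinner x y - cinner x z"
  using cinner_add_right[of x y "- z"] by (simp add: cinner_minus_right)

lemma cinner_zero [simp]: "cinner 0 x = 0" "cinner x 0 = 0"
  using cinner_scaleR_left[of 0 0 x] cinner_scaleR_right[of x 0 0] by simp_all

lemmas cinner_algebra =
  cinner_add_left cinner_add_right cinner_diff_left cinner_diff_right
  cinner_minus_left cinner_minus_right cinner_scaleR_left cinner_scaleR_right
  cinner_scaleC_left cinner_scaleC_right

lemma cinner_sum_left: "cinner (sum f A) y = (\<Sum>i\<in>A. cinner (f i) y)"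
  by (induction A rule: infinite_finite_induct) (simp_all add: cinner_add_left)

lemma cinner_self: "cinner x x = of_real ((norm x)\<^sup>2)"
proof (rule complex_eqI)
  show "Re (cinner x x) = Re (of_real ((norm x)\<^sup>2))"
    by (simp add: Re_cinner power2_norm_eq_inner)
  have "Im (cinner x x) = - Im (cinner x x)"
    using arg_cong[OF cinner_commute[of x x], of Im] by simp
  then show "Im (cinner x x) = Im (of_real ((norm x)\<^sup>2))"
    by simp
qed

lemma norm_scaleC: "norm (c *\<^sub>C x) = cmod c * norm x"
proof -
  have "of_real ((norm (c *\<^sub>C x))\<^sup>2) = complex_of_real ((cmod c * norm x)\<^sup>2)"
    by (simp only: cinner_self[symmetric] cinner_scaleC_left cinner_scaleC_right)
      (use complex_norm_square[of c] in \<open>simp add: cinner_self power_mult_distrib mult_ac\<close>)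
  then have "(norm (c *\<^sub>C x))\<^sup>2 = (cmod c * norm x)\<^sup>2"
    using of_real_eq_iff by blast
  then show ?thesis
    by (simp add: power2_eq_iff_nonneg)
qed

lemma cmod_cinner_le: "cmod (cinner x y) \<le> norm x * norm y"
proof (cases "cinner x y = 0")
  case False
  define u where "u = cnj (cinner x y) / of_real (cmod (cinner x y))"
  have u: "cmod u = 1"
    using False by (simp add: u_def norm_divide)
  have "u * cinner x y = of_real (cmod (cinner x y))"
    using False by (simp add: u_def field_simps flip: complex_norm_square)
      (simp add: power2_eq_square)
  then have "cmod (cinner x y) = inner (u *\<^sub>C x) y"
    by (metis Re_complex_of_real Re_cinner cinner_scaleC_left)
  also have "\<dots> \<le> norm x * norm y"
    using norm_cauchy_schwarz[of "u *\<^sub>C x" y] by (simp add: norm_scaleC u)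
  finally show ?thesis .
qed simp

lemma cinner_eqI:
  assumes "\<And>z. cinner z x = cinner z y"
  shows "x = y"
proof -
  have "cinner (x - y) (x - y) = 0"
    by (simp add: cinner_diff_right assms)
  then show ?thesis
    by (simp add: cinner_self)
qed

text \<open>
  The representing vector minimises \<open>\<parallel>x\<parallel>\<^sup>2 - 2 f x\<close>: a minimising sequence is Cauchy by the parallelogram
  law, and at the minimum the derivative \<open>2 \<langle>x, v\<rangle> - 2 f v\<close> in every direction vanishes.
\<close>

lemma riesz_representation_real:
  fixes f :: "'a::{real_inner, complete_space} \<Rightarrow> real"
  assumes "bounded_linear f"
  obtains y where "\<And>x. f x = inner x y"
proof -
  interpret f: bounded_linear f by fact
  obtain K where K: "\<And>x. norm (f x) \<le> norm x * K" "K \<ge> 0"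
    using f.nonneg_bounded by blast
  define J where "J x = (norm x)\<^sup>2 - 2 * f x" for x
  have Jge: "- K\<^sup>2 \<le> J x" for x
  proof -
    have "f x \<le> norm x * K"
      using K(1)[of x] by simp
    then show ?thesis
      using zero_le_power2[of "norm x - K"] by (simp add: J_def power2_diff)
  qed
  have bdd: "bdd_below (range J)"
    using Jge by (intro bdd_belowI[of _ "- K\<^sup>2"]) auto
  define m where "m = Inf (range J)"
  have m: "m \<le> J x" for x
    unfolding m_def by (rule cInf_lower[OF _ bdd]) simp
  have "\<exists>x. J x < m + inverse (real (Suc n))" for n
    using cInf_lessD[of "range J" "m + inverse (real (Suc n))"] by (auto simp: m_def)
  then obtain X where X: "J (X n) < m + inverse (real (Suc n))" for n
    by metis
  have para: "(norm (x - y))\<^sup>2 \<le> 2 * J x + 2 * J y - 4 * m" for x y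
  proof -
    have "(norm (x - y))\<^sup>2 + 4 * J ((1/2) *\<^sub>R (x + y)) = 2 * J x + 2 * J y"
      by (simp add: J_def power2_norm_eq_inner f.scaleR f.add inner_simps inner_commute algebra_simps)
    then show ?thesis
      using m[of "(1/2) *\<^sub>R (x + y)"] by simp
  qed
  have X': "(norm (X i - X j))\<^sup>2 \<le> 4 * inverse (real (Suc n))" if "i \<ge> n" "j \<ge> n" for i j n
  proof -
    have "inverse (real (Suc i)) \<le> inverse (real (Suc n))" "inverse (real (Suc j)) \<le> inverse (real (Suc n))"
      using that by (auto intro: le_imp_inverse_le)
    then show ?thesis
      using para[of "X i" "X j"] X[of i] X[of j] by argo
  qed
  have "Cauchy X"
    unfolding Cauchy_iff
  proof (intro allI impI)
    fix e :: real assume e: "e > 0"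
    then obtain n where n: "inverse (real (Suc n)) < e\<^sup>2 / 4"
      using reals_Archimedean[of "e\<^sup>2 / 4"] by auto
    have "norm (X i - X j) < e" if "i \<ge> n" "j \<ge> n" for i j
    proof -
      have "(norm (X i - X j))\<^sup>2 < e\<^sup>2"
        using X'[OF that] n by linarith
      then show ?thesis
        by (rule power2_less_imp_less) (use e in simp)
    qed
    then show "\<exists>M. \<forall>i\<ge>M. \<forall>j\<ge>M. norm (X i - X j) < e"
      by blast
  qed
  then obtain y where y: "X \<longlonglongrightarrow> y"
    using Cauchy_convergent_iff convergent_def by blast
  have "(\<lambda>n. J (X n)) \<longlonglongrightarrow> J y"
    unfolding J_def by (intro tendsto_intros f.tendsto y)
  moreover have "(\<lambda>n. m + inverse (real (Suc n))) \<longlonglongrightarrow> m + 0"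
    by (intro tendsto_intros LIMSEQ_inverse_real_of_nat)
  ultimately have Jy: "J y \<le> m"
    using LIMSEQ_le[of "\<lambda>n. J (X n)" "J y" "\<lambda>n. m + inverse (real (Suc n))" m] X
    by (auto intro: less_imp_le)
  have "f x = inner x y" for x
  proof -
    define d where "d = f x - inner x y"
    \<comment> \<open>moving from the minimum by \<open>t x\<close> with the optimal step would decrease \<open>J\<close> unless \<open>d = 0\<close>\<close>
    have ineq: "2 * t * d \<le> t\<^sup>2 * (norm x)\<^sup>2" for t
    proof -
      have "J (y + t *\<^sub>R x) = J y - 2 * t * d + t\<^sup>2 * (norm x)\<^sup>2"
        by (simp add: J_def d_def power2_norm_eq_inner f.scaleR f.add inner_simps inner_commute
            algebra_simps power2_eq_square[of t])
      then show ?thesis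
        using m[of "y + t *\<^sub>R x"] Jy by linarith
    qed
    show ?thesis
    proof (cases "x = 0")
      case False
      have "2 * (d / (norm x)\<^sup>2) * d \<le> (d / (norm x)\<^sup>2)\<^sup>2 * (norm x)\<^sup>2"
        by (rule ineq)
      then have "d\<^sup>2 \<le> 0"
        using False by (simp add: field_simps power2_eq_square)
      then show ?thesis
        by (simp add: d_def)
    qed (simp add: f.zero)
  qed
  then show ?thesis
    by (rule that)
qed

lemma bounded_clinear_imp_bounded_linear: "bounded_clinear T \<Longrightarrow> bounded_linear T"
  by (simp add: bounded_clinear_def)

lemma bounded_clinear_simps:
  assumes "bounded_clinear T"
  shows "T (x + y) = T x + T y" "T (x - y) = T x - T y" "T (- x) = - T x" "T 0 = 0"
    "T (r *\<^sub>R x) = r *\<^sub>R T x" "T (c *\<^sub>C x) = c *\<^sub>C T x"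
  using assms bounded_clinear_imp_bounded_linear[OF assms]
  by (simp_all add: bounded_clinear_def linear_simps)

lemma cinner_cadjoint:
  fixes T :: "'a::chilbert_space \<Rightarrow> 'b::chilbert_space"
  assumes T: "bounded_clinear T"
  shows "cinner (T x) y = cinner x (cadjoint T y)"
proof -
  have "\<exists>s. \<forall>x. cinner (T x) y = cinner x s" for y
  proof -
    have "bounded_linear (\<lambda>x. inner (T x) y)"
      using bounded_linear_compose[OF bounded_linear_inner_left bounded_clinear_imp_bounded_linear[OF T]] .
    then obtain s where s: "\<And>x. inner (T x) y = inner x s"
      using riesz_representation_real by blast
    have "cinner (T x) y = cinner x s" for x
    proof (rule complex_eqI)
      show "Re (cinner (T x) y) = Re (cinner x s)"
        by (simp add: Re_cinner s)
      have "Re (cinner (T (\<i> *\<^sub>C x)) y) = Re (cinner (\<i> *\<^sub>C x) s)"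
        by (simp only: Re_cinner s)
      then show "Im (cinner (T x) y) = Im (cinner x s)"
        by (simp add: bounded_clinear_simps[OF T] cinner_scaleC_left)
    qed
    then show ?thesis by blast
  qed
  then obtain S where S: "\<And>x y. cinner (T x) y = cinner x (S y)"
    by metis
  then have "\<exists>!S. \<forall>x y. cinner (T x) y = cinner x (S y)"
    by (metis cinner_eqI ext)
  from theI'[OF this] show ?thesis
    unfolding cadjoint_def by blast
qed

lemma cinner_cadjoint':
  fixes T :: "'a::chilbert_space \<Rightarrow> 'b::chilbert_space"
  assumes "bounded_clinear T"
  shows "cinner x (T y) = cinner (cadjoint T x) y"
  using cinner_cadjoint[OF assms, of y x] by (metis cinner_commute)

lemma bounded_clinear_cadjoint:
  fixes T :: "'a::chilbert_space \<Rightarrow> 'b::chilbert_space"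
  assumes T: "bounded_clinear T"
  shows "bounded_clinear (cadjoint T)"
proof -
  note A = cinner_cadjoint[OF T, symmetric]
  have add: "cadjoint T (x + y) = cadjoint T x + cadjoint T y" for x y
    by (rule cinner_eqI) (simp add: A cinner_add_right)
  have scl: "cadjoint T (c *\<^sub>C x) = c *\<^sub>C cadjoint T x" for c x
    by (rule cinner_eqI) (simp add: A cinner_scaleC_right)
  obtain K where K: "\<And>x. norm (T x) \<le> norm x * K" "K \<ge> 0"
    using bounded_linear.nonneg_bounded[OF bounded_clinear_imp_bounded_linear[OF T]] by blast
  have "norm (cadjoint T y) \<le> norm y * K" for y
  proof (cases "cadjoint T y = 0")
    case True
    then show ?thesis using K(2) by simp
  next
    case False
    have "norm (cadjoint T y) * norm (cadjoint T y) = cmod (cinner (cadjoint T y) (cadjoint T y))"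
      by (simp add: cinner_self norm_power power2_eq_square norm_mult)
    also have "\<dots> = cmod (cinner (T (cadjoint T y)) y)"
      by (simp add: A)
    also have "\<dots> \<le> norm (T (cadjoint T y)) * norm y"
      by (rule cmod_cinner_le)
    also have "\<dots> \<le> norm (cadjoint T y) * K * norm y"
      by (intro mult_right_mono K(1)) simp
    finally show ?thesis
      using False by (simp add: mult_ac)
  qed
  then show ?thesis
    unfolding bounded_clinear_def
    by (auto intro!: bounded_linear_intro[where K = K] simp: add scl simp flip: scaleC_of_real)
qed

section \<open>Exponentials of skew operators and Fuglede's theorem\<close>

lemma sums_bilinear_Cauchy_product:
  fixes f :: "nat \<Rightarrow> 'a::banach" and g :: "nat \<Rightarrow> 'b::banach" and h :: "'a \<Rightarrow> 'b \<Rightarrow> 'c::banach"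
  assumes h: "bounded_bilinear h"
    and f: "summable (\<lambda>n. norm (f n))" and g: "summable (\<lambda>n. norm (g n))"
  shows "(\<lambda>k. \<Sum>m\<le>k. h (f m) (g (k - m))) sums h (suminf f) (suminf g)"
proof -
  interpret h: bounded_bilinear h by fact
  obtain K where K: "\<And>a b. norm (h a b) \<le> norm a * norm b * K"
    using h.bounded by blast
  have hs_f: "(f has_sum suminf f) UNIV" and hs_g: "(g has_sum suminf g) UNIV"
    using f g by (auto intro!: norm_summable_imp_has_sum summable_sums summable_norm_cancel)
  have sf: "(\<lambda>n. norm (f n)) summable_on UNIV" and sg: "(\<lambda>n. norm (g n)) summable_on UNIV"
    using f g by (auto intro!: norm_summable_imp_summable_on)
  have "(\<lambda>(m, n). norm (f m) * norm (g n)) summable_on UNIV \<times> UNIV"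
  proof (rule summable_on_SigmaI)
    show "((\<lambda>n. case (m, n) of (m, n) \<Rightarrow> norm (f m) * norm (g n))
        has_sum norm (f m) * (\<Sum>\<^sub>\<infinity>n. norm (g n))) UNIV" for m
      using has_sum_cmult_right[OF has_sum_infsum[OF sg], of "norm (f m)"] by simp
    show "(\<lambda>m. norm (f m) * (\<Sum>\<^sub>\<infinity>n. norm (g n))) summable_on UNIV"
      by (intro summable_on_cmult_left sf)
  qed simp
  then have "(\<lambda>p. (case p of (m, n) \<Rightarrow> norm (f m) * norm (g n)) * K) summable_on UNIV \<times> UNIV"
    by (intro summable_on_cmult_left)
  then have "(\<lambda>p. norm (h (f (fst p)) (g (snd p)))) summable_on UNIV \<times> UNIV"
    by (rule summable_on_comparison_test) (auto simp: K split: prod.splits)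
  then have "(\<lambda>p. h (f (fst p)) (g (snd p))) summable_on UNIV \<times> UNIV"
    by (rule abs_summable_summable)
  then obtain S where S: "((\<lambda>p. h (f (fst p)) (g (snd p))) has_sum S) (UNIV \<times> UNIV)"
    by (auto simp: summable_on_def)
  have "((\<lambda>m. h (f m) (suminf g)) has_sum S) UNIV"
    by (rule has_sum_SigmaD[OF S]) (simp add: has_sum_bounded_linear[OF h.bounded_linear_right hs_g])
  moreover have "((\<lambda>m. h (f m) (suminf g)) has_sum h (suminf f) (suminf g)) UNIV"
    by (rule has_sum_bounded_linear[OF h.bounded_linear_left hs_f])
  ultimately have Seq: "S = h (suminf f) (suminf g)"
    by (rule has_sum_unique)
  have "((\<lambda>q. h (f (snd q)) (g (fst q - snd q))) has_sum S) (SIGMA k:UNIV. {..k})"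
    using S
    by (rule has_sum_reindex_bij_witness[where i = "\<lambda>p. (fst p + snd p, fst p)"
          and j = "\<lambda>q. (snd q, fst q - snd q)", THEN iffD2, rotated -1]) auto
  then have "((\<lambda>k. \<Sum>m\<le>k. h (f m) (g (k - m))) has_sum S) UNIV"
    by (rule has_sum_SigmaD) (auto intro!: has_sum_finiteI)
  then show ?thesis
    unfolding Seq by (rule has_sum_imp_sums)
qed

lemma bounded_clinear_commutator:
  assumes S: "bounded_clinear S" and T: "bounded_clinear T"
  shows "bounded_clinear (commutator S T)"
proof -
  note lin = bounded_clinear_imp_bounded_linear
  have "bounded_linear (\<lambda>x. S (T x) - T (S x))"
    using S T by (intro bounded_linear_sub bounded_linear_compose[of S T] bounded_linear_compose[of T S] lin)
  then show ?thesis
    using S T by (simp add: bounded_clinear_def commutator_def scaleC_diff_right)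
qed

text \<open>
  Left and right multiplication by \<open>L\<close> commute, so that the \<open>k\<close>-th power of their difference
  \<open>commutator L\<close> has a binomial expansion.
\<close>

lemma sum_iterated_commutator:
  fixes L A :: "'a::real_vector \<Rightarrow> 'a"
  assumes L: "linear L" and A: "linear A"
  shows "(\<Sum>m\<le>k. (1 / (fact m * fact (k - m))) *\<^sub>R (L ^^ (k - m)) (A (((\<lambda>x. - L x) ^^ m) x)))
    = (1 / fact k) *\<^sub>R ((commutator L ^^ k) A) x"
proof (induction k arbitrary: x)
  case (Suc k)
  let ?M = "\<lambda>x. - L x"
  define b where "b m n x = (1 / (fact m * fact n)) *\<^sub>R (L ^^ n) (A ((?M ^^ m) x))" for m n x
  have LnM: "(L ^^ n) (- u) = - (L ^^ n) u" for n u
    by (induction n) (simp_all add: linear_neg[OF L])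
  have Lb: "L (b m n x) = real (Suc n) *\<^sub>R b m (Suc n) x" for m n
    by (simp add: b_def linear_scale[OF L] field_simps del: of_nat_Suc)
  have Mm: "(?M ^^ m) (L x) = - (?M ^^ Suc m) x" for m
    by (simp add: funpow_swap1[symmetric]) (induction m; simp add: linear_neg[OF L])
  have bL: "b m n (L x) = - (real (Suc m) *\<^sub>R b (Suc m) n x)" for m n
    unfolding b_def Mm linear_neg[OF A] LnM by (simp add: field_simps del: of_nat_Suc)
  have "real (Suc k) *\<^sub>R (\<Sum>m\<le>Suc k. b m (Suc k - m) x)
      = (\<Sum>m\<le>Suc k. real m *\<^sub>R b m (Suc k - m) x) + (\<Sum>m\<le>Suc k. real (Suc k - m) *\<^sub>R b m (Suc k - m) x)"
    unfolding scaleR_right.sum sum.distrib[symmetric] scaleR_left_distrib[symmetric]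
    by (intro sum.cong refl arg_cong2[where f = scaleR]) auto
  also have "(\<Sum>m\<le>Suc k. real m *\<^sub>R b m (Suc k - m) x) = (\<Sum>m\<le>k. real (Suc m) *\<^sub>R b (Suc m) (k - m) x)"
    by (subst sum.atMost_Suc_shift) simp
  also have "\<dots> = - (\<Sum>m\<le>k. b m (k - m) (L x))"
    by (simp add: bL sum_negf)
  also have "(\<Sum>m\<le>Suc k. real (Suc k - m) *\<^sub>R b m (Suc k - m) x)
      = (\<Sum>m\<le>k. real (Suc (k - m)) *\<^sub>R b m (Suc (k - m)) x)"
    by (simp add: Suc_diff_le add_diff_eq)
  also have "\<dots> = L (\<Sum>m\<le>k. b m (k - m) x)"
    by (simp only: linear_sum[OF L] Lb)
  finally have "real (Suc k) *\<^sub>R (\<Sum>m\<le>Suc k. b m (Suc k - m) x)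
      = (1 / fact k) *\<^sub>R ((commutator L ^^ Suc k) A) x"
    unfolding b_def Suc.IH by (simp add: commutator_def linear_scale[OF L] scaleR_diff_right)
  then have "(1 / real (Suc k)) *\<^sub>R real (Suc k) *\<^sub>R (\<Sum>m\<le>Suc k. b m (Suc k - m) x)
      = (1 / real (Suc k)) *\<^sub>R (1 / fact k) *\<^sub>R ((commutator L ^^ Suc k) A) x"
    by simp
  then show ?case
    unfolding b_def by (simp del: of_nat_Suc sum.atMost_Suc funpow.simps)
qed simp

definition op_exp :: "('a::real_normed_vector \<Rightarrow> 'a) \<Rightarrow> 'a \<Rightarrow> 'a" where
  "op_exp T x = (\<Sum>n. (1 / fact n) *\<^sub>R (T ^^ n) x)"

lemma summable_norm_op_exp:
  fixes T :: "'a::real_normed_vector \<Rightarrow> 'a"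
  assumes "bounded_linear T"
  shows "summable (\<lambda>n. norm ((1 / fact n) *\<^sub>R (T ^^ n) x))"
proof -
  obtain K where K: "\<And>x. norm (T x) \<le> norm x * K" "K \<ge> 0"
    using bounded_linear.nonneg_bounded[OF assms] by blast
  have Kn: "norm ((T ^^ n) x) \<le> norm x * K ^ n" for n
  proof (induction n)
    case (Suc n)
    have "norm ((T ^^ Suc n) x) \<le> norm ((T ^^ n) x) * K"
      using K(1) by simp
    also have "\<dots> \<le> norm x * K ^ n * K"
      by (intro mult_right_mono Suc K)
    finally show ?case by (simp add: mult_ac)
  qed simp
  show ?thesis
  proof (rule summable_comparison_test')
    show "summable (\<lambda>n. norm x * (inverse (fact n) * K ^ n))"
      by (intro summable_mult summable_exp)
    show "norm (norm ((1 / fact n) *\<^sub>R (T ^^ n) x)) \<le> norm x * (inverse (fact n) * K ^ n)" for n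
      using Kn[of n] by (simp add: field_simps)
  qed
qed

text \<open>
  For skew \<open>L\<close> the form \<open>\<langle>A e\<^sup>-\<^sup>L x, e\<^sup>-\<^sup>L y\<rangle>\<close> is that of \<open>e\<^sup>L A e\<^sup>-\<^sup>L\<close>, and
  multiplying out the two exponential series gives the Taylor series of this conjugation in the
  iterated commutators of \<open>L\<close> with \<open>A\<close>.
\<close>

lemma sums_conjugation_by_exp:
  fixes L A :: "'a::chilbert_space \<Rightarrow> 'a"
  assumes L: "bounded_clinear L" and A: "bounded_clinear A"
    and skew: "\<And>x y. cinner (L x) y = - cinner x (L y)"
  shows "(\<lambda>k. cinner (((commutator L ^^ k) A) x) y / fact k)
    sums cinner (A (op_exp (\<lambda>x. - L x) x)) (op_exp (\<lambda>x. - L x) y)"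
proof -
  let ?M = "\<lambda>x. - L x"
  note lin = bounded_clinear_imp_bounded_linear
  have M: "bounded_linear ?M"
    by (intro bounded_linear_minus lin L)
  have adj: "cinner u ((?M ^^ n) y) = cinner ((L ^^ n) u) y" for n u
  proof (induction n arbitrary: u)
    case (Suc n)
    have "cinner u ((?M ^^ Suc n) y) = cinner (L u) ((?M ^^ n) y)"
      by (simp add: cinner_minus_right skew)
    then show ?case
      by (simp add: Suc funpow_swap1)
  qed simp
  have h: "bounded_bilinear (\<lambda>u v. cinner (A u) v)"
  proof -
    obtain K where K: "\<And>x. norm (A x) \<le> norm x * K"
      using bounded_linear.bounded[OF lin[OF A]] by blast
    have "cmod (cinner (A u) v) \<le> norm u * norm v * K" for u v
    proof -
      have "cmod (cinner (A u) v) \<le> norm (A u) * norm v"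
        by (rule cmod_cinner_le)
      also have "\<dots> \<le> norm u * K * norm v"
        by (intro mult_right_mono K) simp
      finally show ?thesis by (simp add: mult_ac)
    qed
    then show ?thesis
      by (intro bounded_bilinear.intro)
        (auto simp: bounded_clinear_simps[OF A] cinner_algebra scaleR_conv_of_real)
  qed
  have "(\<Sum>m\<le>k. cinner (A ((1 / fact m) *\<^sub>R (?M ^^ m) x)) ((1 / fact (k - m)) *\<^sub>R (?M ^^ (k - m)) y))
      = cinner (((commutator L ^^ k) A) x) y / fact k" for k
  proof -
    have "(\<Sum>m\<le>k. cinner (A ((1 / fact m) *\<^sub>R (?M ^^ m) x)) ((1 / fact (k - m)) *\<^sub>R (?M ^^ (k - m)) y))
        = cinner (\<Sum>m\<le>k. (1 / (fact m * fact (k - m))) *\<^sub>R (L ^^ (k - m)) (A ((?M ^^ m) x))) y"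
      unfolding cinner_sum_left
      by (simp only: bounded_clinear_simps(5)[OF A] cinner_scaleR_left cinner_scaleR_right)
        (simp add: adj mult.commute)
    also have "\<dots> = cinner (((commutator L ^^ k) A) x) y / fact k"
      using L A
      by (subst sum_iterated_commutator) (simp_all add: lin bounded_linear.linear cinner_scaleR_left)
    finally show ?thesis .
  qed
  then show ?thesis
    using sums_bilinear_Cauchy_product[OF h summable_norm_op_exp[OF M, of x] summable_norm_op_exp[OF M, of y]]
    by (simp add: op_exp_def)
qed

lemma norm_op_exp_skew:
  fixes L :: "'a::chilbert_space \<Rightarrow> 'a"
  assumes L: "bounded_clinear L" and skew: "\<And>x y. cinner (L x) y = - cinner x (L y)"
  shows "norm (op_exp (\<lambda>x. - L x) x) = norm x"
proof -
  have id: "bounded_clinear (\<lambda>x::'a. x)"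
    by (simp add: bounded_clinear_def)
  have "(commutator L ^^ Suc k) (\<lambda>x. x) = (\<lambda>x. 0)" for k
    by (induction k) (simp_all add: commutator_def bounded_clinear_simps[OF L])
  then have 0: "cinner (((commutator L ^^ k) (\<lambda>x. x)) x) x / fact k = 0" if "k \<notin> {0}" for k
    using that by (cases k) (simp_all del: funpow.simps)
  have "cinner (op_exp (\<lambda>x. - L x) x) (op_exp (\<lambda>x. - L x) x) = cinner x x"
    using sums_unique2[OF sums_conjugation_by_exp[OF L id skew, of x x] sums_finite[of "{0}", OF _ 0]]
    by simp
  then have "(norm (op_exp (\<lambda>x. - L x) x))\<^sup>2 = (norm x)\<^sup>2"
    unfolding cinner_self of_real_eq_iff .
  then show ?thesis
    by (simp add: power2_eq_iff_nonneg)
qed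

lemma bounded_power_series_first_coeff:
  fixes c :: "nat \<Rightarrow> complex"
  assumes sum: "\<And>z. summable (\<lambda>n. c n * z ^ n)" and bdd: "\<And>z. cmod (\<Sum>n. c n * z ^ n) \<le> B"
  shows "c 1 = 0"
proof -
  define F where "F z = (\<Sum>n. c n * z ^ n)" for z
  have deriv: "(F has_field_derivative (\<Sum>n. diffs c n * z ^ n)) (at z)" for z
    unfolding F_def using sum by (rule termdiffs_strong_converges_everywhere)
  then have "F holomorphic_on UNIV"
    by (meson holomorphic_onI field_differentiable_at_within field_differentiable_def)
  moreover have "bounded (range F)"
    using bdd by (auto simp: bounded_iff F_def)
  ultimately have "F constant_on UNIV"
    by (rule Liouville_theorem)
  then obtain k where "F = (\<lambda>z. k)"
    by (auto simp: constant_on_def)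
  then have "(F has_field_derivative 0) (at 0)"
    by simp
  then have "(\<Sum>n. diffs c n * 0 ^ n) = 0"
    using deriv[of 0] DERIV_unique by blast
  then show ?thesis
    by (simp add: diffs_def)
qed

text \<open>
  Rosenblum's argument. With \<open>L = z N\<^sup>* - cnj z N\<close>, which is skew, \<open>e\<^sup>L A e\<^sup>-\<^sup>L\<close> has norm at most that of
  \<open>A\<close>. As \<open>N\<close> commutes with \<open>N\<^sup>*\<close> and with \<open>A\<close>, the term \<open>cnj z N\<close> drops out of the iterated commutators, so
  the conjugation is an entire function of \<open>z\<close> with derivative \<open>[N\<^sup>*, A]\<close> at \<open>0\<close>. By Liouville's theorem
  it is constant.
\<close>

theorem fuglede:
  fixes N A :: "'a::chilbert_space \<Rightarrow> 'a"
  assumes N: "normal_op N" and A: "bounded_clinear A" and AN: "\<And>x. A (N x) = N (A x)"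
  shows "A (cadjoint N x) = cadjoint N (A x)"
proof -
  let ?S = "cadjoint N"
  have bN: "bounded_clinear N" and SN: "?S (N u) = N (?S u)" for u
    using N by (auto simp: normal_op_def fun_eq_iff)
  have bS: "bounded_clinear ?S"
    by (rule bounded_clinear_cadjoint[OF bN])
  define B where "B k = (commutator ?S ^^ k) A" for k
  have B: "bounded_clinear (B k) \<and> (\<forall>u. B k (N u) = N (B k u))" for k
  proof (induction k)
    case (Suc k)
    then have "bounded_clinear (commutator ?S (B k))"
      by (intro bounded_clinear_commutator bS) simp
    moreover have "commutator ?S (B k) (N u) = N (commutator ?S (B k) u)" for u
      using Suc by (simp add: commutator_def SN bounded_clinear_simps[OF bN])
    ultimately show ?case
      by (simp add: B_def)
  qed (simp add: B_def A AN)
  obtain K where K: "\<And>x. norm (A x) \<le> norm x * K"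
    using bounded_linear.bounded[OF bounded_clinear_imp_bounded_linear[OF A]] by blast
  have "cinner (B 1 x) y = 0" for y
  proof -
    have *: "summable (\<lambda>k. cinner (B k x) y / fact k * z ^ k)
        \<and> cmod (\<Sum>k. cinner (B k x) y / fact k * z ^ k) \<le> norm x * K * norm y" for z
    proof -
      define L where "L u = z *\<^sub>C ?S u - cnj z *\<^sub>C N u" for u
      have bC: "bounded_linear ((*\<^sub>C) c :: 'a \<Rightarrow> 'a)" for c
        by (rule bounded_linear_intro[where K = "cmod c"])
          (simp_all add: scaleC_add_right norm_scaleC scaleC_scaleC mult.commute flip: scaleC_of_real)
      have L: "bounded_clinear L"
        unfolding bounded_clinear_def
      proof
        show "bounded_linear L"
          unfolding L_def
          by (intro bounded_linear_sub bounded_linear_compose[OF bC] bounded_clinear_imp_bounded_linear bS bN)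
        show "\<forall>c u. L (c *\<^sub>C u) = c *\<^sub>C L u"
          by (simp add: L_def bounded_clinear_simps[OF bN] bounded_clinear_simps[OF bS] scaleC_diff_right
              scaleC_scaleC mult.commute)
      qed
      have skew: "cinner (L u) v = - cinner u (L v)" for u v
        by (simp add: L_def cinner_algebra cinner_cadjoint[OF bN] cinner_cadjoint'[OF bN])
      have adk: "(commutator L ^^ k) A = (\<lambda>u. z ^ k *\<^sub>C B k u)" for k
      proof (induction k)
        case 0
        have "1 *\<^sub>C u = u" for u :: 'a
          using scaleC_of_real[of 1 u] by simp
        then show ?case
          by (simp add: B_def)
      next
        case (Suc k)
        have "bounded_clinear (B k)" "\<And>u. B k (N u) = N (B k u)"
          using B[of k] by auto
        then show ?case
          by (simp add: Suc fun_eq_iff)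
            (simp add: commutator_def B_def L_def bounded_clinear_simps scaleC_diff_right scaleC_scaleC
              bounded_clinear_simps[OF bN] bounded_clinear_simps[OF bS] mult_ac)
      qed
      let ?E = "op_exp (\<lambda>x. - L x)"
      have s: "(\<lambda>k. cinner (B k x) y / fact k * z ^ k) sums cinner (A (?E x)) (?E y)"
        using sums_conjugation_by_exp[OF L A skew, of x y]
        by (simp add: adk cinner_scaleC_left mult_ac)
      have "cmod (cinner (A (?E x)) (?E y)) \<le> norm (A (?E x)) * norm (?E y)"
        by (rule cmod_cinner_le)
      also have "\<dots> \<le> norm (?E x) * K * norm (?E y)"
        by (intro mult_right_mono K) simp
      finally show ?thesis
        using s by (simp add: sums_iff norm_op_exp_skew[OF L skew])
    qed
    have "cinner (B 1 x) y / fact 1 = 0"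
      using bounded_power_series_first_coeff[of "\<lambda>k. cinner (B k x) y / fact k"] * by blast
    then show ?thesis by simp
  qed
  then have "cinner (B 1 x) (B 1 x) = 0" .
  then have "B 1 x = 0"
    by (simp add: cinner_self)
  then show ?thesis
    by (simp add: B_def commutator_def)
qed

section \<open>Hyponormal and subnormal pairs\<close>

text \<open>
  The right-hand side of \<open>le\<close> minus its left-hand side is the quadratic form of the commutator matrix at
  \<open>(x, y)\<close>.
\<close>

lemma hyponormal_pairI:
  fixes T1 T2 :: "'a::chilbert_space \<Rightarrow> 'a"
  assumes T1: "bounded_clinear T1" and T2: "bounded_clinear T2"
    and le: "\<And>x y. (norm (cadjoint T1 x + cadjoint T2 y))\<^sup>2
      \<le> (norm (T1 x))\<^sup>2 + 2 * Re (cinner (T1 y) (T2 x)) + (norm (T2 y))\<^sup>2"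
  shows "hyponormal_pair T1 T2"
proof -
  let ?S1 = "cadjoint T1" and ?S2 = "cadjoint T2"
  let ?M = "op_matrix (commutator ?S1 T1) (commutator ?S2 T1) (commutator ?S1 T2) (commutator ?S2 T2)"
  note S1 = bounded_clinear_cadjoint[OF T1] and S2 = bounded_clinear_cadjoint[OF T2]
  have C: "bounded_clinear (commutator ?S1 T1)" "bounded_clinear (commutator ?S2 T1)"
    "bounded_clinear (commutator ?S1 T2)" "bounded_clinear (commutator ?S2 T2)"
    by (intro bounded_clinear_commutator S1 S2 T1 T2)+
  have "bounded_linear (\<lambda>z. (commutator ?S1 T1 (fst z) + commutator ?S2 T1 (snd z),
      commutator ?S1 T2 (fst z) + commutator ?S2 T2 (snd z)))"
    by (intro bounded_linear_Pair bounded_linear_add bounded_clinear_imp_bounded_linear C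
        bounded_linear_compose[OF _ bounded_linear_fst] bounded_linear_compose[OF _ bounded_linear_snd])
  then have M: "bounded_clinear ?M"
    unfolding bounded_clinear_def
    by (simp add: op_matrix_def case_prod_beta' scaleC_prod_def C[THEN bounded_clinear_simps(6)]
        scaleC_add_right)
  have "cinner (?M z) z \<in> \<real>\<^sub>\<ge>\<^sub>0" for z
  proof (cases z)
    case (Pair x y)
    have "cinner (?M z) z = of_real ((norm (T1 x))\<^sup>2 + 2 * Re (cinner (T1 y) (T2 x)) + (norm (T2 y))\<^sup>2
        - (norm (?S1 x + ?S2 y))\<^sup>2)"
    proof -
      have "cinner (?M z) z = cinner (T1 x) (T1 x) + cinner (T2 y) (T2 y)
          + (cinner (T1 y) (T2 x) + cinner (T2 x) (T1 y)) - cinner (?S1 x + ?S2 y) (?S1 x + ?S2 y)"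
        by (simp add: Pair cinner_prod_def op_matrix_def commutator_def cinner_algebra
            cinner_cadjoint[OF T1] cinner_cadjoint[OF T2] cinner_cadjoint'[OF T1, symmetric]
            cinner_cadjoint'[OF T2, symmetric])
      also have "cinner (T1 y) (T2 x) + cinner (T2 x) (T1 y) = of_real (2 * Re (cinner (T1 y) (T2 x)))"
        by (subst (2) cinner_commute) (rule complex_add_cnj)
      finally show ?thesis
        by (simp add: cinner_self)
    qed
    then show ?thesis
      using le[of x y] by (simp only: nonneg_Reals_of_real_iff)
  qed
  with M show ?thesis
    by (simp add: hyponormal_pair_def positive_op_def T1 T2)
qed

text \<open>
  The hypothesis says that \<open>N\<^sub>1\<^sup>* N\<^sub>1 + N\<^sub>2\<^sup>* N\<^sub>2 - c\<close> annihilates \<open>e\<close> for every normal extension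
  \<open>(N\<^sub>1, N\<^sub>2)\<close>. By Fuglede's theorem this operator commutes with \<open>N\<^sub>1\<close> and \<open>N\<^sub>2\<close>, so that it also
  annihilates the vector \<open>T\<^sub>1 T\<^sub>2 e\<close>.
\<close>

lemma subnormal_pair_eigenvector:
  fixes T1 T2 :: "'a::chilbert_space \<Rightarrow> 'a"
  assumes sub: "subnormal_pair TYPE('k::chilbert_space) T1 T2"
    and e: "(norm (T1 (T1 e)))\<^sup>2 + 2 * (norm (T1 (T2 e)))\<^sup>2 + (norm (T2 (T2 e)))\<^sup>2
      = 2 * c * ((norm (T1 e))\<^sup>2 + (norm (T2 e))\<^sup>2) - c\<^sup>2 * (norm e)\<^sup>2"
  shows "(norm (T1 (T1 (T2 e))))\<^sup>2 + (norm (T2 (T1 (T2 e))))\<^sup>2 = c * (norm (T1 (T2 e)))\<^sup>2"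
proof -
  obtain N1 N2 :: "'k \<Rightarrow> 'k" and V :: "'a \<Rightarrow> 'k" where
    N: "normal_pair N1 N2" and V: "isometric_embedding V"
    and N1V: "\<And>x. N1 (V x) = V (T1 x)" and N2V: "\<And>x. N2 (V x) = V (T2 x)"
    using sub unfolding subnormal_pair_def by blast
  have n1: "normal_op N1" and n2: "normal_op N2" and N12: "N1 (N2 u) = N2 (N1 u)" for u
    using N by (auto simp: normal_pair_def fun_eq_iff)
  have b1: "bounded_clinear N1" and b2: "bounded_clinear N2"
    using n1 n2 by (auto simp: normal_op_def)
  have nV: "norm (V x) = norm x" for x
    using V by (simp add: isometric_embedding_def)
  let ?M1 = "cadjoint N1" and ?M2 = "cadjoint N2"
  have c11: "?M1 (N1 u) = N1 (?M1 u)" and c22: "?M2 (N2 u) = N2 (?M2 u)"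
    and c12: "?M1 (N2 u) = N2 (?M1 u)" and c21: "?M2 (N1 u) = N1 (?M2 u)" for u
    using n1 n2 fuglede[OF n1 b2] fuglede[OF n2 b1] by (auto simp: normal_op_def fun_eq_iff N12)
  note adj = cinner_cadjoint'[OF b1, symmetric] cinner_cadjoint'[OF b2, symmetric]
  define S where "S u = ?M1 (N1 u) + ?M2 (N2 u)" for u
  have SS: "cinner (S u) u = of_real ((norm (N1 u))\<^sup>2 + (norm (N2 u))\<^sup>2)" for u
    by (simp add: S_def cinner_algebra adj cinner_self)
  have "cinner (S u) (S u) = of_real ((norm (N1 (N1 u)))\<^sup>2 + 2 * (norm (N1 (N2 u)))\<^sup>2 + (norm (N2 (N2 u)))\<^sup>2)"
    for u
  proof -
    have "cinner (S u) (S u) = cinner (N1 (N1 u)) (N1 (N1 u)) + cinner (N2 (N1 u)) (N1 (N2 u))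
        + cinner (N1 (N2 u)) (N2 (N1 u)) + cinner (N2 (N2 u)) (N2 (N2 u))"
      by (simp add: S_def cinner_algebra adj flip: c11 c22 c12 c21)
        (simp add: cinner_cadjoint[OF b1, symmetric] cinner_cadjoint[OF b2, symmetric])
    then show ?thesis
      by (simp add: N12 cinner_self)
  qed
  note norm_S = this[unfolded cinner_self of_real_eq_iff]
  define v where "v = V e"
  have "(norm (S v - c *\<^sub>R v))\<^sup>2 = (norm (S v))\<^sup>2 - 2 * c * inner (S v) v + c\<^sup>2 * (norm v)\<^sup>2"
    by (simp add: power2_norm_eq_inner inner_simps inner_commute power2_eq_square[of c] algebra_simps)
  also have "inner (S v) v = (norm (T1 e))\<^sup>2 + (norm (T2 e))\<^sup>2"
    by (simp add: SS v_def N1V N2V nV flip: Re_cinner)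
  also have "(norm (S v))\<^sup>2 = (norm (T1 (T1 e)))\<^sup>2 + 2 * (norm (T1 (T2 e)))\<^sup>2 + (norm (T2 (T2 e)))\<^sup>2"
    by (simp add: norm_S v_def N1V N2V nV)
  finally have "S v - c *\<^sub>R v = 0"
    by (simp add: e v_def nV)
  moreover have "S (N1 (N2 u)) = N1 (N2 (S u))" for u
    by (simp add: S_def c11 c22 c12 c21 N12 bounded_clinear_simps[OF b1] bounded_clinear_simps[OF b2])
  ultimately have Sw: "S (N1 (N2 v)) = c *\<^sub>R N1 (N2 v)"
    by (simp add: bounded_clinear_simps[OF b1] bounded_clinear_simps[OF b2])
  have "(norm (N1 (N1 (N2 v))))\<^sup>2 + (norm (N2 (N1 (N2 v))))\<^sup>2 = inner (S (N1 (N2 v))) (N1 (N2 v))"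
    by (simp add: SS flip: Re_cinner)
  also have "\<dots> = c * (norm (N1 (N2 v)))\<^sup>2"
    by (simp add: Sw power2_norm_eq_inner)
  finally show ?thesis
    by (simp add: v_def N1V N2V nV)
qed

section \<open>Weighted shifts in coordinates\<close>

lemma cinner_ket: "cinner x (ket k) = Rep_ell2 x k"
proof -
  have "cinner x (ket k) = (\<Sum>\<^sub>\<infinity>i\<in>{k}. Rep_ell2 x i)"
    unfolding cinner_ell2_def by (rule infsum_cong_neutral) (auto simp: ket.rep_eq)
  then show ?thesis by simp
qed

lemma norm_ket [simp]: "norm (ket k) = 1"
proof -
  have "complex_of_real ((norm (ket k))\<^sup>2) = 1"
    using cinner_ket[of "ket k" k] by (simp only: cinner_self) (simp add: ket.rep_eq)
  then have "(norm (ket k))\<^sup>2 = 1\<^sup>2"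
    by (simp only: of_real_eq_1_iff one_power2)
  then show ?thesis
    by (rule power2_eq_imp_eq) simp_all
qed

lemma ell2_eqI: "(\<And>i. Rep_ell2 x i = Rep_ell2 y i) \<Longrightarrow> x = y"
  by (metis Rep_ell2_inject ext)

locale bounded_weighted_shift =
  fixes \<sigma> :: "'i \<Rightarrow> 'i" and w :: "'i \<Rightarrow> real" and B :: real
  assumes inj: "inj \<sigma>" and bound: "\<And>i. \<bar>w i\<bar> \<le> B"
begin

lemmas bounded = weighted_shift(1)[OF inj bound]
  and ket = weighted_shift(2)[OF inj bound]

lemma Rep_cadjoint: "Rep_ell2 (cadjoint (weighted_shift \<sigma> w) x) k = w k * Rep_ell2 x (\<sigma> k)"
proof -
  have "Rep_ell2 (cadjoint (weighted_shift \<sigma> w) x) k = cinner x (of_real (w k) *\<^sub>C ket (\<sigma> k))"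
    by (simp add: ket cinner_cadjoint'[OF bounded, symmetric] flip: cinner_ket)
  then show ?thesis
    by (simp add: cinner_scaleC_right cinner_ket)
qed

lemma Rep_image: "Rep_ell2 (weighted_shift \<sigma> w x) (\<sigma> k) = w k * Rep_ell2 x k"
proof -
  have "cadjoint (weighted_shift \<sigma> w) (ket (\<sigma> k)) = of_real (w k) *\<^sub>C ket k"
    using inj by (intro ell2_eqI) (auto simp: Rep_cadjoint scaleC_ell2.rep_eq ket.rep_eq inj_eq)
  then have "Rep_ell2 (weighted_shift \<sigma> w x) (\<sigma> k) = cinner x (of_real (w k) *\<^sub>C ket k)"
    by (simp add: cinner_cadjoint[OF bounded] flip: cinner_ket)
  then show ?thesis
    by (simp add: cinner_scaleC_right cinner_ket)
qed

lemma Rep_outside: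
  assumes "j \<notin> range \<sigma>"
  shows "Rep_ell2 (weighted_shift \<sigma> w x) j = 0"
proof -
  have "cadjoint (weighted_shift \<sigma> w) (ket j) = 0"
    using assms by (intro ell2_eqI) (auto simp: Rep_cadjoint zero_ell2.rep_eq ket.rep_eq)
  then show ?thesis
    by (simp add: cinner_cadjoint[OF bounded] flip: cinner_ket)
qed

lemma has_sum_norm_image:
  "((\<lambda>i. (w i)\<^sup>2 * (cmod (Rep_ell2 x i))\<^sup>2) has_sum (norm (weighted_shift \<sigma> w x))\<^sup>2) UNIV"
proof -
  let ?T = "weighted_shift \<sigma> w"
  have "((\<lambda>j. (cmod (Rep_ell2 (?T x) j))\<^sup>2) has_sum (norm (?T x))\<^sup>2) UNIV"
    unfolding norm_ell2_power2 by (rule has_sum_infsum[OF Rep_ell2_summable])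
  then have "((\<lambda>j. (cmod (Rep_ell2 (?T x) j))\<^sup>2) has_sum (norm (?T x))\<^sup>2) (range \<sigma>)"
    by (rule has_sum_cong_neutral[THEN iffD1, rotated -1]) (auto simp: Rep_outside)
  then show ?thesis
    using inj by (subst (asm) has_sum_reindex) (auto simp: o_def Rep_image norm_mult power_mult_distrib)
qed

end

text \<open>
  Pairing the coordinate of \<open>x\<close> at \<open>k + (1, 0)\<close> with that of \<open>y\<close> at \<open>k + (0, 1)\<close> splits the quadratic form of
  the commutator matrix into the \<open>2 \<times> 2\<close> forms of the hypotheses \<open>diag1\<close>, \<open>diag2\<close> and \<open>det\<close>, plus squares.
\<close>

lemma six_point_test:
  fixes \<alpha> \<beta> :: "nat \<times> nat \<Rightarrow> real"
  assumes \<alpha>: "\<And>k. \<bar>\<alpha> k\<bar> \<le> B" and \<beta>: "\<And>k. \<bar>\<beta> k\<bar> \<le> B"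
    and diag1: "\<And>i j. (\<alpha> (i, j))\<^sup>2 \<le> (\<alpha> (i + 1, j))\<^sup>2"
    and diag2: "\<And>i j. (\<beta> (i, j))\<^sup>2 \<le> (\<beta> (i, j + 1))\<^sup>2"
    and det: "\<And>i j. (\<alpha> (i, j + 1) * \<beta> (i + 1, j) - \<alpha> (i, j) * \<beta> (i, j))\<^sup>2
      \<le> ((\<alpha> (i + 1, j))\<^sup>2 - (\<alpha> (i, j))\<^sup>2) * ((\<beta> (i, j + 1))\<^sup>2 - (\<beta> (i, j))\<^sup>2)"
  shows "hyponormal_pair (shift2_fst \<alpha>) (shift2_snd \<beta>)"
proof -
  define e1 e2 :: "nat \<times> nat \<Rightarrow> nat \<times> nat"
    where "e1 = (\<lambda>(k1, k2). (k1 + 1, k2))" and "e2 = (\<lambda>(k1, k2). (k1, k2 + 1))"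
  have inj: "inj e1" "inj e2"
    by (auto simp: inj_def e1_def e2_def)
  interpret A: bounded_weighted_shift e1 \<alpha> B
    by unfold_locales (use inj \<alpha> in auto)
  interpret B: bounded_weighted_shift e2 \<beta> B
    by unfold_locales (use inj \<beta> in auto)
  define T1 where "T1 = weighted_shift e1 \<alpha>"
  define T2 where "T2 = weighted_shift e2 \<beta>"
  note [folded T1_def, simp] = A.Rep_cadjoint and [folded T2_def, simp] = B.Rep_cadjoint
  have "hyponormal_pair T1 T2"
  proof (rule hyponormal_pairI)
    show "bounded_clinear T1" "bounded_clinear T2"
      unfolding T1_def T2_def by (rule A.bounded B.bounded)+
    fix x y :: "(nat \<times> nat) ell2"
    define u v where "u k = Rep_ell2 x (e1 k)" and "v k = Rep_ell2 y (e2 k)" for k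
    have lhs: "((\<lambda>k. (cmod (\<alpha> k * u k + \<beta> k * v k))\<^sup>2)
        has_sum (norm (cadjoint T1 x + cadjoint T2 y))\<^sup>2) UNIV"
      using has_sum_infsum[OF Rep_ell2_summable[of "cadjoint T1 x + cadjoint T2 y"]]
      by (simp add: norm_ell2_power2 plus_ell2.rep_eq u_def v_def)
    have X: "((\<lambda>i. (\<alpha> i)\<^sup>2 * (cmod (Rep_ell2 x i))\<^sup>2) has_sum (norm (T1 x))\<^sup>2) UNIV"
      and Y: "((\<lambda>i. (\<beta> i)\<^sup>2 * (cmod (Rep_ell2 y i))\<^sup>2) has_sum (norm (T2 y))\<^sup>2) UNIV"
      unfolding T1_def T2_def by (rule A.has_sum_norm_image B.has_sum_norm_image)+
    have part: "\<exists>s'\<le>s. ((\<lambda>k. f (e k)) has_sum s') UNIV"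
      if "(f has_sum s) UNIV" "inj e" "\<And>i. f i \<ge> 0" for f :: "nat \<times> nat \<Rightarrow> real" and e s
    proof -
      have "f summable_on range e"
        using that(1) by (metis has_sum_imp_summable subset_UNIV summable_on_subset_banach)
      then obtain s' where s': "(f has_sum s') (range e)"
        by (auto simp: summable_on_def)
      moreover have "s' \<le> s"
        using s' that(1) by (rule has_sum_mono2) (use that(3) in auto)
      ultimately show ?thesis
        using that(2) by (auto simp: has_sum_reindex o_def)
    qed
    obtain sx where sx: "sx \<le> (norm (T1 x))\<^sup>2" "((\<lambda>k. (\<alpha> (e1 k))\<^sup>2 * (cmod (u k))\<^sup>2) has_sum sx) UNIV"
      using part[OF X inj(1)] by (auto simp: u_def)
    obtain sy where sy: "sy \<le> (norm (T2 y))\<^sup>2" "((\<lambda>k. (\<beta> (e2 k))\<^sup>2 * (cmod (v k))\<^sup>2) has_sum sy) UNIV"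
      using part[OF Y inj(2)] by (auto simp: v_def)
    have e12: "e1 (e2 k) = e2 (e1 k)" for k
      by (simp add: e1_def e2_def split: prod.splits)
    have range: "j \<in> range (\<lambda>k. e1 (e2 k))" if "j \<in> range e1" "j \<in> range e2" for j
      using that by (auto simp: e1_def e2_def image_iff split: prod.splits)
    have off: "Rep_ell2 (T1 y) j * cnj (Rep_ell2 (T2 x) j) = 0" if "j \<notin> range (\<lambda>k. e1 (e2 k))" for j
    proof -
      have "j \<notin> range e1 \<or> j \<notin> range e2"
        using that range by blast
      then show ?thesis
        by (elim disjE) (simp_all add: T1_def T2_def A.Rep_outside B.Rep_outside)
    qed
    have "((\<lambda>j. Rep_ell2 (T1 y) j * cnj (Rep_ell2 (T2 x) j)) has_sum cinner (T1 y) (T2 x)) UNIV"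
      unfolding cinner_ell2_def
      by (rule has_sum_infsum[OF ell2_prod_summable[OF Rep_ell2_summable Rep_ell2_summable]])
    then have "((\<lambda>j. Rep_ell2 (T1 y) j * cnj (Rep_ell2 (T2 x) j)) has_sum cinner (T1 y) (T2 x))
        (range (\<lambda>k. e1 (e2 k)))"
      by (rule has_sum_cong_neutral[THEN iffD1, rotated -1])
        (use off in blast)+
    then have "((\<lambda>k. Rep_ell2 (T1 y) (e1 (e2 k)) * cnj (Rep_ell2 (T2 x) (e2 (e1 k))))
        has_sum cinner (T1 y) (T2 x)) UNIV"
      by (subst (asm) has_sum_reindex) (use inj in \<open>auto simp: o_def e12 inj_eq intro!: injI\<close>)
    then have "((\<lambda>k. of_real (\<alpha> (e2 k) * \<beta> (e1 k)) * (v k * cnj (u k))) has_sum cinner (T1 y) (T2 x)) UNIV"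
      by (simp add: T1_def T2_def A.Rep_image B.Rep_image u_def v_def mult_ac)
    from has_sum_bounded_linear[OF bounded_linear_Re this]
    have cross: "((\<lambda>k. \<alpha> (e2 k) * \<beta> (e1 k) * Re (v k * cnj (u k))) has_sum Re (cinner (T1 y) (T2 x))) UNIV"
      by (simp only: scaleR_conv_of_real[symmetric] scaleR_complex.sel)
    have rhs: "((\<lambda>k. (\<alpha> (e1 k))\<^sup>2 * (cmod (u k))\<^sup>2 + 2 * (\<alpha> (e2 k) * \<beta> (e1 k) * Re (v k * cnj (u k)))
        + (\<beta> (e2 k))\<^sup>2 * (cmod (v k))\<^sup>2) has_sum sx + 2 * Re (cinner (T1 y) (T2 x)) + sy) UNIV"
      by (intro has_sum_add has_sum_cmult_right sx sy cross)
    have "(cmod (\<alpha> k * u k + \<beta> k * v k))\<^sup>2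
        \<le> (\<alpha> (e1 k))\<^sup>2 * (cmod (u k))\<^sup>2 + 2 * (\<alpha> (e2 k) * \<beta> (e1 k) * Re (v k * cnj (u k)))
          + (\<beta> (e2 k))\<^sup>2 * (cmod (v k))\<^sup>2" for k
    proof -
      define r where "r = Re (v k * cnj (u k))"
      define p q where "p = cmod (u k)" and "q = cmod (v k)"
      define D1 D2 m where "D1 = (\<alpha> (e1 k))\<^sup>2 - (\<alpha> k)\<^sup>2" and "D2 = (\<beta> (e2 k))\<^sup>2 - (\<beta> k)\<^sup>2"
        and "m = \<alpha> (e2 k) * \<beta> (e1 k) - \<alpha> k * \<beta> k"
      have D: "D1 \<ge> 0" "D2 \<ge> 0" "m\<^sup>2 \<le> D1 * D2"
        using diag1[of "fst k" "snd k"] diag2[of "fst k" "snd k"] det[of "fst k" "snd k"]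
        by (simp_all add: D1_def D2_def m_def e1_def e2_def case_prod_beta')
      have "\<bar>r\<bar> \<le> p * q"
        using abs_Re_le_cmod[of "v k * cnj (u k)"] by (simp add: r_def p_def q_def norm_mult mult.commute)
      then have r2: "r\<^sup>2 \<le> p\<^sup>2 * q\<^sup>2"
        by (metis abs_ge_zero power2_abs power_mono power_mult_distrib)
      have "(2 * m * r)\<^sup>2 = 4 * (m\<^sup>2 * r\<^sup>2)"
        by (simp add: power_mult_distrib)
      also have "\<dots> \<le> 4 * ((D1 * D2) * (p\<^sup>2 * q\<^sup>2))"
        using D r2 by (intro mult_left_mono mult_mono) auto
      also have "\<dots> \<le> (D1 * p\<^sup>2 + D2 * q\<^sup>2)\<^sup>2"
        using zero_le_power2[of "D1 * p\<^sup>2 - D2 * q\<^sup>2"] by (simp add: power2_eq_square algebra_simps)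
      finally have "\<bar>2 * m * r\<bar> \<le> \<bar>D1 * p\<^sup>2 + D2 * q\<^sup>2\<bar>"
        by (simp only: abs_le_square_iff)
      moreover have "0 \<le> D1 * p\<^sup>2 + D2 * q\<^sup>2"
        using D by simp
      ultimately have "0 \<le> D1 * p\<^sup>2 + 2 * m * r + D2 * q\<^sup>2"
        by linarith
      moreover have "(cmod (\<alpha> k * u k + \<beta> k * v k))\<^sup>2 = (\<alpha> k)\<^sup>2 * p\<^sup>2 + 2 * (\<alpha> k * \<beta> k) * r + (\<beta> k)\<^sup>2 * q\<^sup>2"
        unfolding r_def p_def q_def cmod_power2 by (simp add: power2_eq_square algebra_simps)
      ultimately show ?thesis
        unfolding p_def[symmetric] q_def[symmetric] r_def[symmetric] D1_def D2_def m_def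
        by (simp add: algebra_simps)
    qed
    then have "(norm (cadjoint T1 x + cadjoint T2 y))\<^sup>2 \<le> sx + 2 * Re (cinner (T1 y) (T2 x)) + sy"
      by (rule has_sum_mono[OF lhs rhs])
    then show "(norm (cadjoint T1 x + cadjoint T2 y))\<^sup>2
        \<le> (norm (T1 x))\<^sup>2 + 2 * Re (cinner (T1 y) (T2 x)) + (norm (T2 y))\<^sup>2"
      using sx(1) sy(1) by linarith
  qed
  then show ?thesis
    by (simp add: T1_def T2_def shift2_fst_def shift2_snd_def e1_def e2_def)
qed

section \<open>The weights of the example\<close>

text \<open>
  This is \<open>1 \<le> \<integral>s d\<nu> \<integral>1/s d\<nu>\<close>, obtained by integrating \<open>0 \<le> (1 - t s)\<^sup>2 / s\<close> with
  \<open>t = 1 / \<integral>s d\<nu>\<close>.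
\<close>

lemma berger_measure_inverse_moment:
  assumes \<nu>: "berger_measure \<xi> \<nu>" and inv: "inverse_square_L1 \<nu>" and pos: "0 < \<xi> 1"
  shows "1 / (\<xi> 1)\<^sup>2 \<le> (LINT s|\<nu>. 1 / s)"
proof -
  have sets: "sets \<nu> = sets borel" and "prob_space \<nu>" and AE: "AE s in \<nu>. 0 \<le> s"
    and mom: "(\<Prod>i=1..1. (\<xi> i)\<^sup>2) = (LINT s|\<nu>. s ^ 1)"
    using \<nu> unfolding berger_measure_def by (blast, blast, force, blast)
  interpret prob_space \<nu> by fact
  note [measurable_cong] = sets
  have mean: "(LINT s|\<nu>. s) = (\<xi> 1)\<^sup>2"
    using mom by simp
  have int_id: "integrable \<nu> (\<lambda>s. s)"
    using mean pos not_integrable_integral_eq[of \<nu> "\<lambda>s. s"] by auto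
  have "(\<integral>\<^sup>+ s. 1 / ennreal (s\<^sup>2) \<partial>\<nu>) \<noteq> \<infinity>"
    using inv by (simp add: inverse_square_L1_def)
  then have "AE s in \<nu>. 1 / ennreal (s\<^sup>2) \<noteq> \<infinity>"
    by (intro nn_integral_PInf_AE) auto
  then have AE0: "AE s in \<nu>. 0 < s"
    using AE by eventually_elim (auto simp: less_le)
  have int_inv: "integrable \<nu> (\<lambda>s. 1 / s)"
  proof (rule integrableI_bounded)
    have "ennreal (norm (1 / s)) \<le> 1 + 1 / ennreal (s\<^sup>2)" for s :: real
    proof (cases "s = 0")
      case False
      have "norm (1 / s) \<le> 1 + 1 / s\<^sup>2"
      proof -
        have "(norm (1 / s))\<^sup>2 = 1 / s\<^sup>2"
          by (simp add: power_divide)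
        then show ?thesis
          using zero_le_power2[of "norm (1 / s) - 1"] norm_ge_zero[of "1 / s"]
          unfolding power2_diff one_power2 by linarith
      qed
      then have "ennreal (norm (1 / s)) \<le> ennreal (1 + 1 / s\<^sup>2)"
        by (rule ennreal_leI)
      also have "\<dots> = 1 + 1 / ennreal (s\<^sup>2)"
        using False divide_ennreal[of 1 "s\<^sup>2"] by simp
      finally show ?thesis .
    qed simp
    then have "(\<integral>\<^sup>+ s. ennreal (norm (1 / s)) \<partial>\<nu>) \<le> (\<integral>\<^sup>+ s. 1 + 1 / ennreal (s\<^sup>2) \<partial>\<nu>)"
      by (rule nn_integral_mono)
    also have "\<dots> = 1 + (\<integral>\<^sup>+ s. 1 / ennreal (s\<^sup>2) \<partial>\<nu>)"
      by (subst nn_integral_add) (auto simp: emeasure_space_1)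
    also have "\<dots> < \<infinity>"
      using inv by (simp add: inverse_square_L1_def)
    finally show "(\<integral>\<^sup>+ s. ennreal (norm (1 / s)) \<partial>\<nu>) < \<infinity>" .
  qed simp
  define t where "t = 1 / (\<xi> 1)\<^sup>2"
  have "AE s in \<nu>. 0 \<le> 1 / s - 2 * t + t\<^sup>2 * s"
    using AE0
  proof eventually_elim
    case (elim s)
    then have "1 / s - 2 * t + t\<^sup>2 * s = (1 - t * s)\<^sup>2 / s"
      by (simp add: field_simps power2_eq_square)
    then show ?case
      using elim by simp
  qed
  then have "0 \<le> (LINT s|\<nu>. 1 / s - 2 * t + t\<^sup>2 * s)"
    by (rule integral_nonneg_AE)
  also have "\<dots> = (LINT s|\<nu>. 1 / s) - 2 * t + t\<^sup>2 * (\<xi> 1)\<^sup>2"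
    using int_id int_inv by (simp add: mean prob_space)
  also have "t\<^sup>2 * (\<xi> 1)\<^sup>2 = t"
    using pos by (simp add: t_def power2_eq_square)
  finally show ?thesis
    by (simp add: t_def)
qed

lemma weight_alpha_simps:
  "weight_alpha \<xi> x a b (0, 0) = a"
  "weight_alpha \<xi> x a b (Suc 0, 0) = x"
  "weight_alpha \<xi> x a b (Suc (Suc n), 0) = \<xi> (Suc n)"
  "weight_alpha \<xi> x a b (0, Suc 0) = b"
  "weight_alpha \<xi> x a b (0, Suc (Suc n)) = \<xi> (Suc n) * (b / x)"
  "weight_alpha \<xi> x a b (Suc m, Suc n) = \<xi> (Suc m)"
  by simp_all

text \<open>Here \<open>x\<close> is \<open>\<xi>\<^sub>e\<close>; the measure enters through \<open>x \<le> \<xi> 1\<close>.\<close>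

locale example_weights =
  fixes \<xi> :: "nat \<Rightarrow> real" and x a b :: real
  assumes \<xi>_pos: "0 < \<xi> 1" and \<xi>_mono: "\<And>n. n \<ge> 1 \<Longrightarrow> \<xi> n < \<xi> (n + 1)" and \<xi>_less_1: "\<And>n. n \<ge> 1 \<Longrightarrow> \<xi> n < 1"
    and x_pos: "0 < x" and x_le: "x \<le> \<xi> 1"
    and a_pos: "0 < a" and b_pos: "0 < b" and b_le: "b \<le> x\<^sup>2" and ab: "2 * a\<^sup>2 = b\<^sup>2 + x\<^sup>2"
begin

abbreviation "\<alpha> \<equiv> weight_alpha \<xi> x a b"
abbreviation "\<beta> \<equiv> weight_beta \<xi> x a b"

declare weight_alpha.simps [simp del]

lemma \<xi>_ge: "\<xi> 1 \<le> \<xi> (Suc n)" and \<xi>_gt_0: "0 < \<xi> (Suc n)" and \<xi>_le_1: "\<xi> (Suc n) \<le> 1"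
  and \<xi>_Suc: "\<xi> (Suc n) \<le> \<xi> (Suc (Suc n))"
proof -
  show 1: "\<xi> 1 \<le> \<xi> (Suc n)"
  proof (induction n)
    case (Suc n)
    then show ?case
      using \<xi>_mono[of "Suc n"] by simp
  qed simp
  show "0 < \<xi> (Suc n)"
    using 1 \<xi>_pos by linarith
  show "\<xi> (Suc n) \<le> 1" "\<xi> (Suc n) \<le> \<xi> (Suc (Suc n))"
    using \<xi>_less_1[of "Suc n"] \<xi>_mono[of "Suc n"] by simp_all
qed

lemma x_less_1: "x < 1"
  using \<xi>_less_1[of 1] x_le by linarith

lemma a_less: "a < x"
proof -
  have "b\<^sup>2 \<le> (x\<^sup>2)\<^sup>2"
    using b_pos b_le by (intro power_mono) auto
  also have "(x\<^sup>2)\<^sup>2 < x\<^sup>2"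
    using x_pos x_less_1 power_strict_decreasing[of 2 4 x] by (simp flip: power_mult)
  finally have "a\<^sup>2 < x\<^sup>2"
    using ab by linarith
  then show ?thesis
    by (rule power2_less_imp_less) (use x_pos in simp)
qed

lemma ratio: "0 < b / x" "b / x \<le> x"
  using b_pos x_pos b_le by (simp_all add: field_simps power2_eq_square)

lemma b_less: "b \<le> x"
  using mult_left_le[of x x] x_pos x_less_1 b_le unfolding power2_eq_square by linarith

lemma \<xi>_ratio: "\<xi> (Suc n) * (b / x) \<le> \<xi> 1"
proof -
  have "\<xi> (Suc n) * (b / x) \<le> 1 * (b / x)"
    by (intro mult_right_mono \<xi>_le_1 less_imp_le ratio)
  then show ?thesis
    using ratio x_le by linarith
qed

lemma \<alpha>_bounds: "0 < \<alpha> (i, j) \<and> \<alpha> (i, j) \<le> 1"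
proof -
  note S = weight_alpha_simps
  show ?thesis
  proof (cases i)
    case 0
    show ?thesis
    proof (cases j)
      case 0
      then show ?thesis
        using \<open>i = 0\<close> a_pos a_less x_less_1 by (simp add: S)
    next
      case (Suc n)
      have "0 < \<xi> (Suc m) * (b / x)" for m
        by (intro mult_pos_pos \<xi>_gt_0 ratio)
      moreover have "\<xi> (Suc m) * (b / x) \<le> 1" for m
        using \<xi>_ratio[of m] \<xi>_le_1[of 0] by simp
      ultimately show ?thesis
        using Suc \<open>i = 0\<close> b_pos b_less x_less_1
        by (cases n) (simp_all add: S del: times_divide_eq_right)
    qed
  next
    case (Suc m)
    then show ?thesis
      using x_pos x_less_1 \<xi>_gt_0 \<xi>_le_1 by (cases j; cases m) (auto simp: S)
  qed
qed

lemma \<alpha>_mono: "\<alpha> (i, j) \<le> \<alpha> (Suc i, j)"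
proof -
  note S = weight_alpha_simps
  show ?thesis
  proof (cases j)
    case 0
    show ?thesis
    proof (cases i)
      case (Suc m)
      then show ?thesis
        using 0 x_le \<xi>_Suc by (cases m) (simp_all add: S)
    qed (use 0 a_less in \<open>simp add: S\<close>)
  next
    case (Suc n)
    show ?thesis
    proof (cases i)
      case 0
      then show ?thesis
        using Suc b_less x_le \<xi>_ratio by (cases n) (simp_all add: S)
    qed (use Suc \<xi>_Suc in \<open>simp add: S\<close>)
  qed
qed

text \<open>
  At the origin the form is \<open>(x\<^sup>2 - a\<^sup>2) \<bar>u - v\<bar>\<^sup>2\<close>, because \<open>b\<^sup>2 - a\<^sup>2 = - (x\<^sup>2 - a\<^sup>2)\<close>: it is degenerate, and
  this is what the proof of non-subnormality exploits. Along the axes the weights satisfy a proportionality,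
  \<open>\<alpha> (0, k + 1) = (b / x) \<alpha> (k + 1, 0)\<close>, so that the off-diagonal entry is \<open>b / x\<close> times a diagonal one;
  in the interior it vanishes.
\<close>

lemma \<alpha>_det:
  "(\<alpha> (i, Suc j) * \<alpha> (j, Suc i) - \<alpha> (i, j) * \<alpha> (j, i))\<^sup>2
    \<le> ((\<alpha> (Suc i, j))\<^sup>2 - (\<alpha> (i, j))\<^sup>2) * ((\<alpha> (Suc j, i))\<^sup>2 - (\<alpha> (j, i))\<^sup>2)" (is "?det i j")
proof -
  note S = weight_alpha_simps
  have nonneg: "0 \<le> (\<alpha> (Suc i, j))\<^sup>2 - (\<alpha> (i, j))\<^sup>2" for i j
    using power_mono[OF \<alpha>_mono, of i j 2] \<alpha>_bounds[of i j] by simp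
  have axis: "(p * (p * r) - q * (q * r))\<^sup>2 \<le> (p\<^sup>2 - q\<^sup>2) * ((\<xi> 1)\<^sup>2 - (q * r)\<^sup>2)"
    if "0 \<le> q" "q \<le> p" "0 \<le> r" "p * r \<le> \<xi> 1" for p q r
  proof -
    have "(p * r)\<^sup>2 \<le> (\<xi> 1)\<^sup>2"
      using that by (intro power_mono) auto
    moreover have "q\<^sup>2 \<le> p\<^sup>2"
      using that by (intro power_mono) auto
    ultimately have "0 \<le> (p\<^sup>2 - q\<^sup>2) * ((\<xi> 1)\<^sup>2 - (p * r)\<^sup>2)"
      by simp
    also have "\<dots> = (p\<^sup>2 - q\<^sup>2) * ((\<xi> 1)\<^sup>2 - (q * r)\<^sup>2) - (p * (p * r) - q * (q * r))\<^sup>2"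
      by (simp add: power2_eq_square algebra_simps)
    finally show ?thesis
      by simp
  qed
  have origin: "?det 0 0"
  proof -
    have "b * b - a * a = - (x\<^sup>2 - a\<^sup>2)"
      using ab by (simp add: power2_eq_square)
    then show ?thesis
      by (simp only: S power2_minus) (simp add: power2_eq_square)
  qed
  have right: "?det (Suc m) 0" for m
  proof (cases m)
    case 0
    then show ?thesis
      using axis[of x "\<xi> 1" "b / x"] x_pos x_le ratio \<xi>_ratio[of 0] by (simp add: S)
  next
    case (Suc n)
    then show ?thesis
      using axis[of "\<xi> (Suc n)" "\<xi> (Suc (Suc n))" "b / x"] \<xi>_gt_0[of n] \<xi>_Suc[of n] ratio
        \<xi>_ratio[of "Suc n"]
      by (simp add: S)
  qed
  have sym: "?det i j" if "?det j i" for i j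
    using that by (simp add: mult.commute)
  show ?thesis
  proof (cases i; cases j)
    fix m n assume "i = Suc m" "j = Suc n"
    then show ?thesis
      using mult_nonneg_nonneg[OF nonneg[of i j] nonneg[of j i]] by (simp add: S)
  qed (use origin right sym[OF right] in simp_all)
qed

lemma hyponormal: "hyponormal_pair (shift2_fst \<alpha>) (shift2_snd \<beta>)"
proof (rule six_point_test)
  show "\<bar>\<alpha> k\<bar> \<le> 1" "\<bar>\<beta> k\<bar> \<le> 1" for k
    using \<alpha>_bounds[of "fst k" "snd k"] \<alpha>_bounds[of "snd k" "fst k"] by (cases k; simp)+
  show "(\<alpha> (i, j))\<^sup>2 \<le> (\<alpha> (i + 1, j))\<^sup>2" "(\<beta> (i, j))\<^sup>2 \<le> (\<beta> (i, j + 1))\<^sup>2" for i j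
    using \<alpha>_mono[of i j] \<alpha>_mono[of j i] \<alpha>_bounds[of i j] \<alpha>_bounds[of j i]
    by (auto intro!: power_mono)
  show "(\<alpha> (i, j + 1) * \<beta> (i + 1, j) - \<alpha> (i, j) * \<beta> (i, j))\<^sup>2
      \<le> ((\<alpha> (i + 1, j))\<^sup>2 - (\<alpha> (i, j))\<^sup>2) * ((\<beta> (i, j + 1))\<^sup>2 - (\<beta> (i, j))\<^sup>2)" for i j
    using \<alpha>_det[of i j] by simp
qed

lemma not_subnormal: "\<not> subnormal_pair TYPE('k::chilbert_space) (shift2_fst \<alpha>) (shift2_snd \<beta>)"
proof
  let ?T1 = "shift2_fst \<alpha>" and ?T2 = "shift2_snd \<beta>" and ?e = "ket (0, 0) :: (nat \<times> nat) ell2"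
  assume sub: "subnormal_pair TYPE('k) ?T1 ?T2"
  have inj: "inj (\<lambda>(k1, k2). (k1 + 1, k2) :: nat \<times> nat)" "inj (\<lambda>(k1, k2). (k1, k2 + 1) :: nat \<times> nat)"
    by (auto simp: inj_def)
  have bdd: "\<bar>\<alpha> k\<bar> \<le> 1" "\<bar>\<beta> k\<bar> \<le> 1" for k
    using \<alpha>_bounds[of "fst k" "snd k"] \<alpha>_bounds[of "snd k" "fst k"] by (cases k; simp)+
  note ws1 = weighted_shift[OF inj(1) bdd(1), folded shift2_fst_def]
    and ws2 = weighted_shift[OF inj(2) bdd(2), folded shift2_snd_def]
  have T1: "?T1 (of_real r *\<^sub>C ket (i, j)) = of_real (r * \<alpha> (i, j)) *\<^sub>C ket (Suc i, j)" for r i j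
    by (simp add: bounded_clinear_simps(6)[OF ws1(1)] ws1(2) scaleC_scaleC)
  have T2: "?T2 (of_real r *\<^sub>C ket (i, j)) = of_real (r * \<alpha> (j, i)) *\<^sub>C ket (i, Suc j)" for r i j
    by (simp add: bounded_clinear_simps(6)[OF ws2(1)] ws2(2) scaleC_scaleC)
  have e: "of_real 1 *\<^sub>C ?e = ?e"
    by (simp only: scaleC_of_real) simp
  note T1e = T1[of 1 0 0, unfolded e] and T2e = T2[of 1 0 0, unfolded e]
  have nrm: "(norm (of_real r *\<^sub>C ket k))\<^sup>2 = r\<^sup>2" for r and k :: "nat \<times> nat"
    by (simp only: norm_scaleC norm_ket) simp
  note S = weight_alpha_simps
  have x4: "2 * (a * x)\<^sup>2 + 2 * (a * b)\<^sup>2 = 2 * (2 * a\<^sup>2) * (2 * a\<^sup>2) - (2 * a\<^sup>2)\<^sup>2"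
  proof -
    have "2 * (a * x)\<^sup>2 + 2 * (a * b)\<^sup>2 = 2 * a\<^sup>2 * (b\<^sup>2 + x\<^sup>2)"
      by (simp add: power_mult_distrib algebra_simps)
    also have "\<dots> = 2 * (2 * a\<^sup>2) * (2 * a\<^sup>2) - (2 * a\<^sup>2)\<^sup>2"
      unfolding ab[symmetric] by (simp add: power2_eq_square)
    finally show ?thesis .
  qed
  have "(norm (?T1 (?T1 (?T2 ?e))))\<^sup>2 + (norm (?T2 (?T1 (?T2 ?e))))\<^sup>2 = (2 * a\<^sup>2) * (norm (?T1 (?T2 ?e)))\<^sup>2"
    using sub
  proof (rule subnormal_pair_eigenvector)
    show "(norm (?T1 (?T1 ?e)))\<^sup>2 + 2 * (norm (?T1 (?T2 ?e)))\<^sup>2 + (norm (?T2 (?T2 ?e)))\<^sup>2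
        = 2 * (2 * a\<^sup>2) * ((norm (?T1 ?e))\<^sup>2 + (norm (?T2 ?e))\<^sup>2) - (2 * a\<^sup>2)\<^sup>2 * (norm ?e)\<^sup>2"
      unfolding T1e T2e T1 T2 nrm S using x4 by simp
  qed
  then have "2 * (a * b * \<xi> 1)\<^sup>2 = 2 * a\<^sup>2 * (a * b)\<^sup>2"
    unfolding T1e T2e T1 T2 nrm S by simp
  then have "(a * b)\<^sup>2 * (\<xi> 1)\<^sup>2 = (a * b)\<^sup>2 * a\<^sup>2"
    by (simp only: power_mult_distrib mult.assoc mult.commute mult.left_commute)
  then have "(\<xi> 1)\<^sup>2 = a\<^sup>2"
    using a_pos b_pos by (simp only: mult_cancel_left) simp
  then have "\<xi> 1 = a"
    using a_pos \<xi>_pos by (simp add: power2_eq_iff_nonneg)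
  then show False
    using a_less x_le by linarith
qed

end

theorem theorem4p3:
  fixes \<xi> :: "nat \<Rightarrow> real" and \<nu> :: "real measure" and \<xi>e a b :: real
    and T1 T2 :: "(nat \<times> nat) ell2 \<Rightarrow> (nat \<times> nat) ell2"
  assumes "0 < \<xi> 1" and "\<forall>n\<ge>1. \<xi> n < \<xi> (n + 1)" and "\<xi> \<longlonglongrightarrow> 1"
    and "subnormal TYPE('h::chilbert_space) (unilateral_shift \<xi>)" and "berger_measure \<xi> \<nu>"
    and "inverse_square_L1 \<nu>"
    and "\<xi>e = (LINT s|\<nu>. 1 / s) powr (- 1 / 2)"
    and "a > 0"
    and "sqrt (\<xi>e\<^sup>2 / 2) < a" and "a \<le> sqrt ((\<xi>e\<^sup>2 + \<xi>e ^ 4) / 2)"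
    and "a \<le> 1 / \<xi>e * (LINT s|\<nu>. 1 / s\<^sup>2) powr (- 1 / 2)"
    and "b = sqrt (2 * a\<^sup>2 - \<xi>e\<^sup>2)"
    and "T1 = shift2_fst (weight_alpha \<xi> \<xi>e a b)"
    and "T2 = shift2_snd (weight_beta \<xi> \<xi>e a b)"
  shows "(0 < \<xi> 1 \<and> (\<forall>n\<ge>1. \<xi> n < \<xi> (n + 1)) \<and> \<xi> \<longlonglongrightarrow> 1) \<and>
    (subnormal TYPE('h) (unilateral_shift \<xi>) \<and> berger_measure \<xi> \<nu>) \<and>
    inverse_square_L1 \<nu> \<and>
    \<xi>e = (LINT s|\<nu>. 1 / s) powr (- 1 / 2) \<and>
    a \<le> 1 / \<xi>e * (LINT s|\<nu>. 1 / s\<^sup>2) powr (- 1 / 2) \<and>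
    b \<le> \<xi>e\<^sup>2 \<and>
    a\<^sup>2 \<le> (b\<^sup>2 + \<xi>e\<^sup>2) / 2 \<and>
    hyponormal_pair T1 T2 \<and>
    \<not> subnormal_pair TYPE('k::chilbert_space) T1 T2"
proof -
  interpret prob_space \<nu>
    using assms(5) by (simp add: berger_measure_def)
  have \<xi>_less_1: "\<xi> n < 1" if "n \<ge> 1" for n
  proof -
    have "incseq (\<lambda>n. \<xi> (Suc n))"
      using assms(2) by (intro incseq_SucI) (simp add: less_imp_le)
    then have "\<xi> (Suc n) \<le> 1"
      by (rule incseq_le) (use assms(3) LIMSEQ_Suc in blast)
    then show ?thesis
      using assms(2) that by (metis Suc_eq_plus1 less_le_trans)
  qed
  define I where "I = (LINT s|\<nu>. 1 / s)"
  have I_ge: "1 / (\<xi> 1)\<^sup>2 \<le> I"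
    unfolding I_def by (rule berger_measure_inverse_moment[OF assms(5,6,1)])
  then have I_pos: "0 < I"
    using assms(1) by (smt (verit) divide_pos_pos zero_less_power)
  have \<xi>e_pos: "0 < \<xi>e"
    unfolding assms(7) I_def[symmetric] using I_pos by simp
  have \<xi>e_sq: "\<xi>e\<^sup>2 = 1 / I"
    unfolding assms(7) I_def[symmetric] using I_pos
    by (simp add: power2_eq_square powr_minus_divide flip: powr_add)
  have "\<xi>e\<^sup>2 \<le> (\<xi> 1)\<^sup>2"
    unfolding \<xi>e_sq using I_ge I_pos assms(1) by (simp add: field_simps)
  then have \<xi>e_le: "\<xi>e \<le> \<xi> 1"
    by (rule power2_le_imp_le) (use assms(1) in simp)
  have a_lower: "\<xi>e\<^sup>2 / 2 < a\<^sup>2"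
  proof -
    have "(sqrt (\<xi>e\<^sup>2 / 2))\<^sup>2 < a\<^sup>2"
      using assms(9) by (intro power_strict_mono) auto
    then show ?thesis
      by simp
  qed
  have a_upper: "a\<^sup>2 \<le> (\<xi>e\<^sup>2 + \<xi>e ^ 4) / 2"
  proof -
    have "a\<^sup>2 \<le> (sqrt ((\<xi>e\<^sup>2 + \<xi>e ^ 4) / 2))\<^sup>2"
      using assms(8,10) by (intro power_mono) auto
    then show ?thesis
      by simp
  qed
  have b_sq: "b\<^sup>2 = 2 * a\<^sup>2 - \<xi>e\<^sup>2"
    unfolding assms(12) using a_lower by simp
  have b_pos: "0 < b"
    unfolding assms(12) using a_lower by simp
  have "b\<^sup>2 \<le> (\<xi>e\<^sup>2)\<^sup>2"
    using a_upper by (simp add: b_sq flip: power_mult)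
  then have b_le: "b \<le> \<xi>e\<^sup>2"
    by (rule power2_le_imp_le) simp
  interpret example_weights \<xi> \<xi>e a b
    by unfold_locales (use assms(1,2,8) \<xi>_less_1 \<xi>e_pos \<xi>e_le b_pos b_le b_sq in auto)
  have "hyponormal_pair T1 T2" "\<not> subnormal_pair TYPE('k) T1 T2"
    unfolding assms(13,14) by (rule hyponormal not_subnormal)+
  moreover have "a\<^sup>2 \<le> (b\<^sup>2 + \<xi>e\<^sup>2) / 2"
    by (simp add: b_sq)
  ultimately show ?thesis
    using assms(1-7,11) b_le by blast
qed

end
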